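(* For every initial surplus $x\in\mathbb{N}$ and every $n\geq1$, $$\mathbb{P}_{\boldsymbol{\pi},x}(\tau_0^-\geq n+1)=\boldsymbol{\pi}\left(\sum_{i=0}^{x+n-1}\mathbf{\Lambda}^{*n}(i)-\sum_{j=x+1}^{x+n-1}\ \sum_{\nu=j}^{x+n-1}\mathbf{\Lambda}^{*(j-x)}(j)\,\mathbf{V}(n+x-j,\,n+x-\nu)\right)\vec{\boldsymbol{e}}.$$
   Context: $\mathbb{N}=\{0,1,2,\dots\}$. $\{J_n\}_{n\in\mathbb{N}}$ is an ergodic time-homogeneous Markov chain on $E=\{1,\dots,N\}$ with transition matrix $\mathbf{P}$ and stationary distribution $\boldsymbol{\pi}$ (an $N$-dimensional row vector). The claims $\{C_k\}_{k\ge1}$ are non-negative integer-valued and conditionally i.i.d. given the chain in the sense that $(C,J)$ has the Markov additive property: given $J_{k-1}=i$, the pair $(C_k,J_k)$ is independent of the past and $\lambda_{ij}(m):=\mathbb{P}(C_k=m,J_k=j\mid J_{k-1}=i)$ does not depend on $k$. $\mathbf{\Lambda}(m)=(\lambda_{ij}(m))_{i,j\in E}$, so $\sum_{m\ge0}\mathbf{\Lambda}(m)=\mathbf{P}$. Standing assumption: $\lambda_{ij}(0)>0$ for all $i,j\in E$ and $\mathbf{\Lambda}(0)$ is invertible. The surplus process (compound Markov binomial model) is $X_n=x+n-S_n$, $S_n=\sum_{k=1}^nC_k$, $S_0=0$. The ruin time is $\tau_0^-=\min\{n>0:X_n\leq0\}$ (with $\min\emptyset=\infty$). $\mathbb{P}_{\boldsymbol{\pi},x}$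 denotes probability when $J_0\sim\boldsymbol{\pi}$ and $X_0=x$. $\mathbf{\Lambda}^{*n}(m)=\sum_{m_1+\cdots+m_n=m}\mathbf{\Lambda}(m_1)\cdots\mathbf{\Lambda}(m_n)$ is the $n$-fold (matrix) convolution, and $\vec{\boldsymbol{e}}$ is the $N$-dimensional column vector of ones. Definition of $\mathbf{V}(n,a)$. Let $\mathbf{R}=(R_{ij})_{i,j\in E}$ be a matrix of $N^2$ independent variables and $D_{ij}=\partial/\partial R_{ij}$. Put $\widehat{\mathbf{\Lambda}}^{\rightarrow}(\mathbf{R})=\sum_{m\ge0}\mathbf{R}^m\mathbf{\Lambda}(m)$ and $\widehat\lambda^{\rightarrow}_{ij}(\mathbf{R})=(\widehat{\mathbf{\Lambda}}^{\rightarrow}(\mathbf{R}))_{ij}$. Let $\mathbf{\Gamma}^{\rightarrow}(\mathbf{R})$ be the $N^2\times N^2$ matrix with entries $\gamma_{ij,kl}(\mathbf{R})=R_{ij}\,D_{kl}\{\ln[\widehat\lambda^{\rightarrow}_{ij}(\mathbf{R})]\}$, $i,j,k,l\in E$ (rows indexed by pairs $ij$, columns by pairs $kl$), let $\mathbf{I}$ be the $N^2\times N^2$ identity matrix and $|\cdot|$ the determinant. Then $$\mathbf{V}(n,a)=\sum_{\substack{x_{11},\dots,x_{NN}\ge0\\ x_{11}+\cdots+x_{NN}=n}}\frac{1}{x_{11}!\cdots x_{NN}!}\,\mathbf{C}(\vec x,a),$$ $$\mathbf{C}(\vec x,a)=\left[\prod_{i=1}^N\prod_{j=1}^ND_{ij}^{x_{ij}}\left(\mathbf{R}^a\prod_{i=1}^N\prod_{j=1}^N\widehat\lambda^{\rightarrow}_{ij}(\mathbf{R})^{x_{ij}}\,\big|\mathbf{I}-\mathbf{\Gamma}^{\rightarrow}(\mathbf{R})\big|\right)\right]_{\mathbf{R}=\mathbf{0}},$$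 where the sum is over vectors $\vec x=(x_{ij})_{i,j\in E}$ of $N^2$ non-negative integers, the differential operators act on everything to their right, and they act element-wise on the matrix $\mathbf{R}^a$. *)

theory Defs
  imports "HOL-Probability.Probability"
begin

primrec matpow :: "real^'n^'n \<Rightarrow> nat \<Rightarrow> real^'n^'n" where
  "matpow A 0 = mat 1"
| "matpow A (Suc k) = A ** matpow A k"

subsection \<open>Finite Markov chains\<close>

definition stochastic :: "real^'n^'n \<Rightarrow> bool" where
  "stochastic P \<longleftrightarrow> (\<forall>i j. 0 \<le> P $ i $ j) \<and> (\<forall>i. (\<Sum>j\<in>UNIV. P $ i $ j) = 1)"

definition irreducible_chain :: "real^'n^'n \<Rightarrow> bool" where
  "irreducible_chain P \<longleftrightarrow> (\<forall>i j. \<exists>k. 0 < matpow P k $ i $ j)"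

definition aperiodic_chain :: "real^'n^'n \<Rightarrow> bool" where
  "aperiodic_chain P \<longleftrightarrow> (\<forall>i. Gcd {k. 0 < k \<and> 0 < matpow P k $ i $ i} = 1)"

definition ergodic_chain :: "real^'n^'n \<Rightarrow> bool" where
  "ergodic_chain P \<longleftrightarrow> irreducible_chain P \<and> aperiodic_chain P"

definition stationary_distribution :: "real^'n^'n \<Rightarrow> real^'n \<Rightarrow> bool" where
  "stationary_distribution P \<pi> \<longleftrightarrow>
     (\<forall>i. 0 \<le> \<pi> $ i) \<and> (\<Sum>i\<in>UNIV. \<pi> $ i) = 1 \<and> \<pi> v* P = \<pi>"

subsection \<open>The compound Markov binomial model\<close>

text \<open>The past up to time \<open>k\<close>: the values \<open>J\<^sub>0, \<dots>, J\<^sub>k\<close> and \<open>C\<^sub>1, \<dots>, C\<^sub>k\<close>.\<close>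

definition past :: "(nat \<Rightarrow> 'w \<Rightarrow> 'n) \<Rightarrow> (nat \<Rightarrow> 'w \<Rightarrow> nat) \<Rightarrow> nat \<Rightarrow> 'w \<Rightarrow> 'n list \<times> nat list" where
  "past J C k \<omega> = (map (\<lambda>l. J l \<omega>) [0..<Suc k], map (\<lambda>l. C l \<omega>) [1..<Suc k])"

text \<open>
  The state space \<open>E = {1, \<dots>, N}\<close> is the universe of the finite type \<open>'n\<close>.
  \<open>M\<close> is the probability measure under which \<open>J\<^sub>0\<close> has distribution \<open>\<pi>\<close>; the initial
  surplus enters as a parameter of \<open>surplus\<close>. \<open>C 0\<close> plays no role. Conditioning on
  events of probability 0 yields 0 in the library, so \<open>independent_past\<close> needs no guard;
  as \<open>past\<close> takes countably many values, its sets \<open>B\<close> give all events of the past.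
\<close>

locale compound_markov_binomial = prob_space M
  for M :: "'w measure" +
  fixes J :: "nat \<Rightarrow> 'w \<Rightarrow> 'n::finite"
    and C :: "nat \<Rightarrow> 'w \<Rightarrow> nat"
    and P :: "real^'n^'n"
    and \<pi> :: "real^'n"
    and \<Lambda> :: "nat \<Rightarrow> real^'n^'n"
  assumes J_measurable: "\<And>k. J k \<in> measurable M (count_space UNIV)"
    and C_measurable: "\<And>k. 1 \<le> k \<Longrightarrow> C k \<in> measurable M (count_space UNIV)"
    and stochastic: "stochastic P"
    and ergodic: "ergodic_chain P"
    and stationary: "stationary_distribution P \<pi>"
    and initial: "\<And>i. \<P>(\<omega> in M. J 0 \<omega> = i) = \<pi> $ i"
    and transition: "\<And>k i j. 0 < \<P>(\<omega> in M. J k \<omega> = i) \<Longrightarrow>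
      \<P>(\<omega> in M. J (Suc k) \<omega> = j \<bar> J k \<omega> = i) = P $ i $ j"
    and kernel: "\<And>k i j m. 0 < \<P>(\<omega> in M. J k \<omega> = i) \<Longrightarrow>
      \<P>(\<omega> in M. C (Suc k) \<omega> = m \<and> J (Suc k) \<omega> = j \<bar> J k \<omega> = i) = \<Lambda> m $ i $ j"
    and independent_past: "\<And>k i j m B.
      \<P>(\<omega> in M. (C (Suc k) \<omega> = m \<and> J (Suc k) \<omega> = j) \<and> past J C k \<omega> \<in> B \<bar> J k \<omega> = i) =
      \<P>(\<omega> in M. C (Suc k) \<omega> = m \<and> J (Suc k) \<omega> = j \<bar> J k \<omega> = i) *
      \<P>(\<omega> in M. past J C k \<omega> \<in> B \<bar> J k \<omega> = i)"
    and \<Lambda>_sums: "\<Lambda> sums P"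
    and \<Lambda>_0_pos: "\<And>i j. 0 < \<Lambda> 0 $ i $ j"
    and \<Lambda>_0_invertible: "invertible (\<Lambda> 0)"

definition surplus :: "(nat \<Rightarrow> 'w \<Rightarrow> nat) \<Rightarrow> nat \<Rightarrow> nat \<Rightarrow> 'w \<Rightarrow> int" where
  "surplus C x n \<omega> = int x + int n - int (\<Sum>k=1..n. C k \<omega>)"

text \<open>In \<^typ>\<open>enat\<close> the infimum of a nonempty set is its minimum, and that of the empty set is \<open>\<infinity>\<close>.\<close>

definition ruin_time :: "(nat \<Rightarrow> 'w \<Rightarrow> nat) \<Rightarrow> nat \<Rightarrow> 'w \<Rightarrow> enat" where
  "ruin_time C x \<omega> = Inf {enat n | n. 0 < n \<and> surplus C x n \<omega> \<le> 0}"

definition conv_power :: "(nat \<Rightarrow> real^'n^'n) \<Rightarrow> nat \<Rightarrow> nat \<Rightarrow> real^'n^'n" where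
  "conv_power \<Lambda> n m =
     (\<Sum>ms | length ms = n \<and> sum_list ms = m. foldr (\<lambda>k A. \<Lambda> k ** A) ms (mat 1))"

subsection \<open>The matrices \<open>V(n, a)\<close>\<close>

text \<open>Functions of \<open>N\<^sup>2\<close> real variables are functions of a matrix \<open>R\<close>. All series and
  logarithms below are only meaningful for \<open>R\<close> near 0, where they are eventually evaluated.\<close>

definition partial_deriv :: "'n \<Rightarrow> 'n \<Rightarrow> (real^'n^'n \<Rightarrow> real) \<Rightarrow> real^'n^'n \<Rightarrow> real" where
  "partial_deriv i j f R = deriv (\<lambda>t. f (R + t *\<^sub>R axis i (axis j 1))) 0"

text \<open>The operator \<open>\<Prod>\<^sub>i \<Prod>\<^sub>j D\<^sub>i\<^sub>j\<close>, with exponents \<open>x i j\<close>, as a composition in increasing order of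
  the indices.\<close>

definition multi_deriv ::
  "('n::{finite,linorder} \<Rightarrow> 'n::{finite,linorder} \<Rightarrow> nat) \<Rightarrow>
    (real^('n::{finite,linorder})^('n::{finite,linorder}) \<Rightarrow> real) \<Rightarrow>
    real^('n::{finite,linorder})^('n::{finite,linorder}) \<Rightarrow> real" where
  "multi_deriv x f =
     (let E = sorted_list_of_set (UNIV :: 'n::{finite,linorder} set)
      in foldr (\<lambda>i. foldr (\<lambda>j. partial_deriv i j ^^ x i j) E) E f)"

definition Lambda_hat :: "(nat \<Rightarrow> real^'n^'n) \<Rightarrow> real^'n^'n \<Rightarrow> real^'n^'n" where
  "Lambda_hat \<Lambda> R = (\<Sum>m. matpow R m ** \<Lambda> m)"

definition Gamma_mat :: "(nat \<Rightarrow> real^'n^'n) \<Rightarrow> real^'n^'n \<Rightarrow> real^('n \<times> 'n)^('n \<times> 'n)" where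
  "Gamma_mat \<Lambda> R = (\<chi> p q. case p of (i, j) \<Rightarrow> case q of (k, l) \<Rightarrow>
     R $ i $ j * partial_deriv k l (\<lambda>S. ln (Lambda_hat \<Lambda> S $ i $ j)) R)"

definition C_mat :: "(nat \<Rightarrow> real^('n::{finite,linorder})^('n::{finite,linorder})) \<Rightarrow>
    ('n::{finite,linorder} \<Rightarrow> 'n::{finite,linorder} \<Rightarrow> nat) \<Rightarrow> nat \<Rightarrow>
    real^('n::{finite,linorder})^('n::{finite,linorder})" where
  "C_mat \<Lambda> x a = (\<chi> r s. multi_deriv x
     (\<lambda>R. matpow R a $ r $ s
        * (\<Prod>i\<in>UNIV. \<Prod>j\<in>UNIV. (Lambda_hat \<Lambda> R $ i $ j) ^ x i j)
        * det (mat 1 - Gamma_mat \<Lambda> R)) 0)"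

definition V_mat :: "(nat \<Rightarrow> real^('n::{finite,linorder})^('n::{finite,linorder})) \<Rightarrow>
    nat \<Rightarrow> nat \<Rightarrow> real^('n::{finite,linorder})^('n::{finite,linorder})" where
  "V_mat \<Lambda> n a =
     (\<Sum>x | (\<Sum>i\<in>UNIV. \<Sum>j\<in>UNIV. x i j) = n.
        (1 / (\<Prod>i\<in>UNIV. \<Prod>j\<in>UNIV. fact (x i j))) *\<^sub>R C_mat \<Lambda> x a)"

end

theory Submission
  imports Defs "HOL-Library.Function_Algebras"
begin

text \<open>
  The surplus rises by at most one per period. If it is positive at time \<open>n\<close> although it was not
  positive at some earlier time after 0, then it was exactly 0 at that time or later, and cutting
  the path at the last such time \<open>k\<close> gives an initial piece with \<open>S\<^sub>k = x + k\<close> followed by a piece that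
  starts at level 0 and stays positive. The theorem follows once \<open>V n a\<close> is known to be the matrix
  weight of the \<open>n\<close>-step paths from level 0 to level \<open>a\<close> that are positive at all times after 0.
  Splitting off the last claim \<open>c\<close>, these path weights are determined by

    \<^item> \<open>V 0 a = (if a = 0 then mat 1 else 0)\<close>,
    \<^item> \<open>V n 0 = 0\<close> for \<open>n > 0\<close>,
    \<^item> \<open>V (n + 1) (a + 1) = (\<Sum>c. V n (a + c) ** \<Lambda> c)\<close>.

  Proving these three relations from the definition by derivatives at 0 is the core of the file
  (\<open>V_mat_zero_steps\<close>, \<open>V_mat_level_zero\<close>, \<open>V_mat_last_step\<close>). Let \<open>F(R)\<close> be \<open>Lambda_hat\<close> and \<open>f\<^sub>p\<close>, for
  an index pair \<open>p\<close>, its entries, and write \<open>[R\<^sup>\<alpha>] g\<close> for the Taylor coefficient at 0. Then \<open>V n a\<close> is the sum over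
  all multi-indices \<open>\<alpha>\<close> of degree \<open>n\<close> of \<open>[R\<^sup>\<alpha>] (R\<^sup>a \<cdot> f\<^sup>\<alpha> \<cdot> det (I - \<Gamma>))\<close>, the expression of Good's
  multivariate Lagrange inversion formula.

  The third relation is a shift of coefficients: a factor \<open>R\<^sub>p\<close> of \<open>R\<^sup>a\<^sup>+\<^sup>1 = R\<^sup>a R\<close> lowers \<open>\<alpha>\<^sub>p\<close> by one and
  leaves behind one factor \<open>f\<^sub>p\<close> of \<open>f\<^sup>\<alpha>\<close>, and \<open>R\<^sup>a F(R) = (\<Sum>c. R\<^sup>a\<^sup>+\<^sup>c \<Lambda>(c))\<close>. The second relation is
  Good's identity \<open>[R\<^sup>\<alpha>] (f\<^sup>\<alpha> \<cdot> det (I - \<Gamma>)) = 0\<close> for \<open>\<alpha> \<noteq> 0\<close> (\<open>good_det_coefficient_eq_0\<close>). Up to a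
  conjugation, the rows of the scaled determinant with \<open>\<alpha>\<^sub>p > 0\<close> are \<open>\<alpha>\<^sub>p \<delta>\<^sub>p\<^sub>q h\<^sub>p - R\<^sub>q \<partial>\<^sub>q h\<^sub>p\<close> with
  \<open>h\<^sub>p = f\<^sub>p ^ \<alpha>\<^sub>p\<close>. Expanding every row in monomials, with exponent \<open>B\<^sub>p\<close> in row \<open>p\<close>, turns \<open>R\<^sub>q \<partial>\<^sub>q\<close> into
  multiplication by \<open>B\<^sub>p\<^sub>q\<close>, and the coefficient becomes a combination of determinants of numbers whose
  rows with \<open>\<alpha>\<^sub>p > 0\<close> are \<open>\<alpha>\<^sub>p \<delta>\<^sub>p\<^sub>q - B\<^sub>p\<^sub>q\<close>, over all \<open>B\<close> with column sums \<open>\<alpha>\<^sub>q\<close>. These rows sum to 0, so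
  all the determinants vanish (\<open>index_det_eq_0\<close>).

  Divisions by \<open>f\<^sub>p\<close> are avoided by working on slices: if \<open>\<alpha>\<^sub>p = 0\<close>, the derivatives
  at 0 only see the values at points with \<open>R\<^sub>p = 0\<close>, where row \<open>p\<close> of \<open>I - \<Gamma>\<close> is a unit vector;
  if \<open>\<alpha>\<^sub>p > 0\<close>, a factor \<open>f\<^sub>p\<close> of \<open>f\<^sup>\<alpha>\<close> clears the denominator. All functions that remain
  are convergent power series in the entries of \<open>R\<close>.

  On the probabilistic side the Markov property gives the same recursion over the last claim for the
  joint law of survival, total claim amount and state of the chain (\<open>survival_law_Suc\<close>). By the three
  relations, the matrix \<open>survival_matrix\<close> that cutting at the last visit to 0 suggests satisfies this
  recursion as well, so the two agree.
\<close>

section \<open>Power series in the entries of a matrix\<close>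

definition entry :: "real^'n^'n \<Rightarrow> 'n \<times> 'n \<Rightarrow> real" where
  "entry R p = R $ fst p $ snd p"

definition mpow :: "real^'n^'n \<Rightarrow> ('n \<times> 'n \<Rightarrow> nat) \<Rightarrow> real" where
  "mpow R \<alpha> = (\<Prod>p\<in>UNIV. entry R p ^ \<alpha> p)"

definition unit_index :: "'v \<Rightarrow> 'v \<Rightarrow> nat" where
  "unit_index p q = (if q = p then 1 else 0)"

definition in_box :: "real \<Rightarrow> real^'n^'n \<Rightarrow> bool" where
  "in_box r R \<longleftrightarrow> (\<forall>p. \<bar>entry R p\<bar> < r)"

text \<open>
  The notion asks for unordered, hence absolute, convergence in the whole open box, so that terms may be
  regrouped freely.
\<close>

definition has_series ::
  "real \<Rightarrow> (('n \<times> 'n \<Rightarrow> nat) \<Rightarrow> real) \<Rightarrow> (real^'n^'n \<Rightarrow> real) \<Rightarrow> bool" where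
  "has_series r c f \<longleftrightarrow> (\<forall>R. in_box r R \<longrightarrow> ((\<lambda>\<alpha>. c \<alpha> * mpow R \<alpha>) has_sum f R) UNIV)"

definition conv :: "(('v \<Rightarrow> nat) \<Rightarrow> real) \<Rightarrow> (('v \<Rightarrow> nat) \<Rightarrow> real) \<Rightarrow> ('v \<Rightarrow> nat) \<Rightarrow> real" where
  "conv c d \<alpha> = (\<Sum>z | fst z + snd z = \<alpha>. c (fst z) * d (snd z))"

lemma sum_fun_apply: "(\<Sum>a\<in>S. f a) x = (\<Sum>a\<in>S. f a x :: 'b::comm_monoid_add)"
  by (induction S rule: infinite_finite_induct) auto

lemma mpow_add: "mpow R (\<alpha> + \<beta>) = mpow R \<alpha> * mpow R \<beta>"
  by (simp add: mpow_def power_add prod.distrib)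

lemma mpow_zero [simp]: "mpow R 0 = 1"
  by (simp add: mpow_def)

lemma mpow_sum: "mpow R (\<Sum>a\<in>S. s a) = (\<Prod>a\<in>S. mpow R (s a))"
  by (induction S rule: infinite_finite_induct) (simp_all only: mpow_add sum.empty sum.infinite sum.insert prod.empty prod.infinite prod.insert mpow_zero not_False_eq_True)

lemma mpow_unit: "mpow R (unit_index p) = entry R p"
proof -
  have "mpow R (unit_index p) = (\<Prod>q\<in>UNIV. if q = p then entry R p else 1)"
    unfolding mpow_def unit_index_def by (intro prod.cong) auto
  then show ?thesis by simp
qed

lemma has_seriesD:
  assumes "has_series r c f" "in_box r R"
  shows "((\<lambda>\<alpha>. c \<alpha> * mpow R \<alpha>) has_sum f R) UNIV"
  using assms by (simp add: has_series_def)

text \<open>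
  Expansions arise over all kinds of index sets: pairs of multi-indices for a product, families of
  multi-indices for a determinant. Collecting the terms with equal exponent brings them to standard form;
  the fibres are finite because exponents only add up.
\<close>

lemma has_series_regroup:
  fixes f :: "real^'n^'n \<Rightarrow> real"
  assumes fin: "\<And>\<alpha>. finite {a\<in>I. s a = \<alpha>}"
    and sum: "\<And>R. in_box r R \<Longrightarrow> ((\<lambda>a. c a * mpow R (s a)) has_sum f R) I"
  shows "has_series r (\<lambda>\<alpha>. \<Sum>a | a \<in> I \<and> s a = \<alpha>. c a) f"
  unfolding has_series_def
proof (intro allI impI)
  fix R :: "real^'n^'n" assume R: "in_box r R"
  have bij: "bij_betw snd (Sigma UNIV (\<lambda>\<alpha>. {a\<in>I. s a = \<alpha>})) I"
    by (rule bij_betwI[where g = "\<lambda>a. (s a, a)"]) auto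
  have "((\<lambda>z. c (snd z) * mpow R (s (snd z))) has_sum f R) (Sigma UNIV (\<lambda>\<alpha>. {a\<in>I. s a = \<alpha>}))"
    using sum[OF R] has_sum_reindex_bij_betw[OF bij, of "\<lambda>a. c a * mpow R (s a)" "f R"] by simp
  then show "((\<lambda>\<alpha>. (\<Sum>a | a \<in> I \<and> s a = \<alpha>. c a) * mpow R \<alpha>) has_sum f R) UNIV"
  proof (rule has_sum_SigmaD)
    fix \<alpha>
    show "((\<lambda>y. c (snd (\<alpha>, y)) * mpow R (s (snd (\<alpha>, y)))) has_sum
        (\<Sum>a | a \<in> I \<and> s a = \<alpha>. c a) * mpow R \<alpha>) {a \<in> I. s a = \<alpha>}"
      by (subst has_sum_finite_iff[OF fin]) (simp add: sum_distrib_right)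
  qed
qed

lemma finite_index_le: "finite {\<beta>::'v::finite \<Rightarrow> nat. \<forall>p. \<beta> p \<le> \<alpha> p}"
proof -
  have "{\<beta>::'v \<Rightarrow> nat. \<forall>p. \<beta> p \<le> \<alpha> p} = PiE UNIV (\<lambda>p. {..\<alpha> p})"
    by (auto simp: PiE_def)
  then show ?thesis by (simp add: finite_PiE)
qed

lemma finite_index_splits: "finite {z. fst z + snd z = (\<alpha> :: 'v::finite \<Rightarrow> nat)}"
proof (rule finite_subset)
  show "{z. fst z + snd z = \<alpha>} \<subseteq> {\<beta>. \<forall>p. \<beta> p \<le> \<alpha> p} \<times> {\<beta>. \<forall>p. \<beta> p \<le> \<alpha> p}"
    by auto
qed (simp add: finite_index_le)

lemma has_sum_mult_real:
  fixes f :: "'a \<Rightarrow> real" and g :: "'b \<Rightarrow> real"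
  assumes "(f has_sum x) A" "(g has_sum y) B"
  shows "((\<lambda>(a, b). f a * g b) has_sum x * y) (A \<times> B)"
proof (rule has_sum_SigmaI)
  have abs: "(\<lambda>a. norm (f a)) summable_on A" "(\<lambda>b. norm (g b)) summable_on B"
    using assms[THEN has_sum_imp_summable, THEN summable_on_iff_abs_summable_on_real[THEN iffD1]]
    by blast+
  have "(\<lambda>(a, b). norm (f a) * norm (g b)) summable_on A \<times> B"
  proof (rule summable_on_SigmaI)
    show "((\<lambda>b. case (a, b) of (a, b) \<Rightarrow> norm (f a) * norm (g b)) has_sum
        norm (f a) * infsum (\<lambda>b. norm (g b)) B) B" for a
      using has_sum_cmult_right[OF has_sum_infsum[OF abs(2)]] by simp
    show "(\<lambda>a. norm (f a) * infsum (\<lambda>b. norm (g b)) B) summable_on A"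
      by (rule summable_on_cmult_left[OF abs(1)])
  qed auto
  then have "(\<lambda>z. norm (case z of (a, b) \<Rightarrow> f a * g b)) summable_on A \<times> B"
    by (simp only: case_prod_beta' norm_mult)
  then show "(\<lambda>(a, b). f a * g b) summable_on A \<times> B"
    by (rule abs_summable_summable)
qed (use assms in \<open>auto intro!: has_sum_cmult_right has_sum_cmult_left\<close>)

lemma has_series_mult:
  assumes "has_series r c f" "has_series r d g"
  shows "has_series r (conv c d) (\<lambda>R. f R * g R)"
proof -
  have "has_series r (\<lambda>\<alpha>. \<Sum>a | a \<in> UNIV \<and> fst a + snd a = \<alpha>. c (fst a) * d (snd a)) (\<lambda>R. f R * g R)"
  proof (rule has_series_regroup)
    fix \<alpha> :: "'a \<times> 'a \<Rightarrow> nat"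
    show "finite {a \<in> UNIV. fst a + snd a = \<alpha>}"
      using finite_index_splits[of \<alpha>] by simp
  next
    fix R :: "real^'a^'a" assume "in_box r R"
    from has_sum_mult_real[OF assms[THEN has_seriesD, OF this]]
    show "((\<lambda>a. c (fst a) * d (snd a) * mpow R (fst a + snd a)) has_sum f R * g R) UNIV"
      by (simp only: case_prod_beta' mpow_add mult_ac UNIV_Times_UNIV)
  qed
  then show ?thesis by (simp add: conv_def[abs_def])
qed

lemma has_series_const: "has_series r (\<lambda>\<alpha>. if \<alpha> = 0 then k else 0) (\<lambda>R. k)"
  unfolding has_series_def
proof (intro allI impI)
  fix R :: "real^'a^'a"
  have "((\<lambda>\<alpha>. k * mpow R \<alpha>) has_sum k) {0}"
    by (rule has_sum_finiteI) auto
  then show "((\<lambda>\<alpha>. (if \<alpha> = 0 then k else 0) * mpow R \<alpha>) has_sum k) UNIV"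
    by (rule has_sum_cong_neutral[THEN iffD1, rotated 3]) auto
qed

lemma has_series_entry: "has_series r (\<lambda>\<alpha>. if \<alpha> = unit_index p then 1 else 0) (\<lambda>R. entry R p)"
  unfolding has_series_def
proof (intro allI impI)
  fix R :: "real^'a^'a"
  have "((\<lambda>\<alpha>. mpow R \<alpha>) has_sum entry R p) {unit_index p}"
    by (rule has_sum_finiteI) (auto simp: mpow_unit)
  then show "((\<lambda>\<alpha>. (if \<alpha> = unit_index p then 1 else 0) * mpow R \<alpha>) has_sum entry R p) UNIV"
    by (rule has_sum_cong_neutral[THEN iffD1, rotated 3]) auto
qed

lemma has_series_cmult: "has_series r c f \<Longrightarrow> has_series r (\<lambda>\<alpha>. k * c \<alpha>) (\<lambda>R. k * f R)"
  unfolding has_series_def by (auto intro!: has_sum_cmult_right simp: mult.assoc)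

lemma has_series_add:
  "has_series r c f \<Longrightarrow> has_series r d g \<Longrightarrow> has_series r (\<lambda>\<alpha>. c \<alpha> + d \<alpha>) (\<lambda>R. f R + g R)"
  unfolding has_series_def by (auto intro!: has_sum_add simp: distrib_right)

lemma has_series_sum:
  "(\<And>a. a \<in> S \<Longrightarrow> has_series r (c a) (f a)) \<Longrightarrow>
    has_series r (\<lambda>\<alpha>. \<Sum>a\<in>S. c a \<alpha>) (\<lambda>R. \<Sum>a\<in>S. f a R)"
proof (induction S rule: infinite_finite_induct)
  case (insert a S)
  then have "has_series r (\<lambda>\<alpha>. c a \<alpha> + (\<Sum>a\<in>S. c a \<alpha>)) (\<lambda>R. f a R + (\<Sum>a\<in>S. f a R))"
    by (intro has_series_add) auto
  with insert show ?case by simp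
qed (simp_all add: has_series_def)

section \<open>Termwise differentiation\<close>

definition shift_entry :: "'n \<times> 'n \<Rightarrow> real \<Rightarrow> real^'n^'n \<Rightarrow> real^'n^'n" where
  "shift_entry p t R = R + t *\<^sub>R axis (fst p) (axis (snd p) 1)"

lemma entry_shift: "entry (shift_entry p t R) q = entry R q + (if q = p then t else 0)"
  by (auto simp: entry_def shift_entry_def axis_def prod_eq_iff)

definition mpow_rest :: "'n \<times> 'n \<Rightarrow> real^'n^'n \<Rightarrow> ('n \<times> 'n \<Rightarrow> nat) \<Rightarrow> real" where
  "mpow_rest p R \<alpha> = (\<Prod>q\<in>UNIV - {p}. entry R q ^ \<alpha> q)"

lemma mpow_split: "mpow R \<alpha> = mpow_rest p R \<alpha> * entry R p ^ \<alpha> p"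
  by (simp add: mpow_def mpow_rest_def prod.remove[of UNIV p] mult.commute)

lemma mpow_shift: "mpow (shift_entry p t R) \<alpha> = mpow_rest p R \<alpha> * (entry R p + t) ^ \<alpha> p"
  by (simp add: mpow_split[of _ _ p] entry_shift mpow_rest_def)

lemma in_box_shift: "in_box r R \<Longrightarrow> \<bar>entry R p + t\<bar> < r \<Longrightarrow> in_box r (shift_entry p t R)"
  by (auto simp: in_box_def entry_shift)

text \<open>
  The square is the square of \<open>k * sqrt q ^ k\<close>, which even tends to 0.
\<close>

lemma square_times_geometric_bounded:
  fixes q :: real
  assumes "0 < q" "q < 1"
  shows "\<exists>B\<ge>0. \<forall>k. (real k)\<^sup>2 * q ^ k \<le> B"
proof -
  have "(\<lambda>k. real k * sqrt q ^ k) \<longlonglongrightarrow> 0"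
    using powser_times_n_limit_0[of "sqrt q"] assms by simp
  then have "Bseq (\<lambda>k. real k * sqrt q ^ k)"
    by (intro convergent_imp_Bseq) (auto simp: convergent_def)
  then obtain B where B: "B > 0" "\<And>k. norm (real k * sqrt q ^ k) \<le> B"
    by (auto elim: BseqE)
  have "(real k)\<^sup>2 * q ^ k \<le> B\<^sup>2" for k
  proof -
    have "(real k)\<^sup>2 * q ^ k = (real k * sqrt q ^ k)\<^sup>2"
      using assms by (simp add: power_mult_distrib)
        (simp add: power2_eq_square flip: power_mult_distrib)
    also have "\<dots> \<le> B\<^sup>2"
      using B by (intro power2_le_iff_abs_le[THEN iffD2]) auto
    finally show ?thesis .
  qed
  then show ?thesis by (intro exI[of _ "B\<^sup>2"]) auto
qed

text \<open>
  First and second derivatives of \<open>z ^ k\<close> at radius \<open>K\<close> are dominated by \<open>s ^ k\<close> for any larger radius \<open>s\<close>,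
  uniformly in \<open>k\<close>. This reduces the convergence of differentiated series to that of the series itself.
\<close>

lemma derivative_coefficients_bounded:
  fixes K s :: real
  assumes "0 < K" "K < s"
  obtains B where "B \<ge> 0"
    "\<And>k. real k * K ^ (k - Suc 0) \<le> B * s ^ k"
    "\<And>k. real k * real (k - Suc 0) * K ^ (k - 2) \<le> B * s ^ k"
proof -
  obtain B where B: "B \<ge> 0" "\<And>k. (real k)\<^sup>2 * (K / s) ^ k \<le> B"
    using square_times_geometric_bounded[of "K / s"] assms by auto
  have B': "(real k)\<^sup>2 * K ^ k \<le> B * s ^ k" for k
    using B(2)[of k] assms by (simp add: power_divide field_simps)
  define D where "D = max (B / K) (B / K\<^sup>2)"
  have D: "B / K \<le> D" "B / K\<^sup>2 \<le> D"
    by (auto simp: D_def)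
  show ?thesis
  proof (rule that)
    show "D \<ge> 0" using D(1) B(1) assms divide_nonneg_pos[of B K] by linarith
    fix k :: nat
    have "k \<le> k\<^sup>2" by (cases k) (auto simp: power2_eq_square)
    then have "real k \<le> (real k)\<^sup>2" by (metis of_nat_le_iff of_nat_power)
    then have "real k * K ^ k \<le> (real k)\<^sup>2 * K ^ k"
      using assms by (intro mult_right_mono) auto
    then have "real k * K ^ k \<le> B * s ^ k"
      using B'[of k] by linarith
    then have "real k * K ^ k / K \<le> B * s ^ k / K"
      using assms by (intro divide_right_mono) auto
    moreover have "real k * K ^ (k - Suc 0) = real k * K ^ k / K"
      using assms by (cases k) auto
    ultimately have "real k * K ^ (k - Suc 0) \<le> B / K * s ^ k"
      by simp
    also have "\<dots> \<le> D * s ^ k"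
      using D assms by (intro mult_right_mono) auto
    finally show "real k * K ^ (k - Suc 0) \<le> D * s ^ k" .
    have "real k * real (k - Suc 0) * K ^ (k - 2) \<le> (real k)\<^sup>2 * K ^ k / K\<^sup>2"
    proof (cases "k \<ge> 2")
      case True
      then have "K ^ k = K ^ (k - 2) * K\<^sup>2"
        by (metis le_add_diff_inverse2 power_add)
      moreover have "real k * real (k - Suc 0) \<le> (real k)\<^sup>2"
        by (simp add: power2_eq_square mult_left_mono)
      ultimately show ?thesis
        using assms by (simp add: mult_right_mono)
    next
      case False
      then have "k = 0 \<or> k = 1" by auto
      then show ?thesis using assms by auto
    qed
    also have "\<dots> \<le> B / K\<^sup>2 * s ^ k"
      using divide_right_mono[OF B'[of k], of "K\<^sup>2"] by simp
    also have "\<dots> \<le> D * s ^ k"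
      using D assms by (intro mult_right_mono) auto
    finally show "real k * real (k - Suc 0) * K ^ (k - 2) \<le> D * s ^ k" .
  qed
qed

lemma partial_deriv_shift: "partial_deriv (fst p) (snd p) f R = deriv (\<lambda>t. f (shift_entry p t R)) 0"
  by (simp add: partial_deriv_def shift_entry_def)

text \<open>
  The series is differentiated along one coordinate inside the unordered sum, without rearranging it
  into a power series in that coordinate: the error of the difference quotient of each term is at most
  \<open>\<bar>h\<bar>\<close> times a summable bound.
\<close>

lemma has_series_derivative:
  assumes f: "has_series r c f" and R: "in_box r R"
  shows "\<exists>D. ((\<lambda>t. f (shift_entry p t R)) has_real_derivative D) (at 0) \<and>
    ((\<lambda>\<alpha>. c \<alpha> * (mpow_rest p R \<alpha> * (real (\<alpha> p) * entry R p ^ (\<alpha> p - Suc 0)))) has_sum D) UNIV"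
proof -
  define z where "z = entry R p"
  have "\<bar>z\<bar> < r" using R unfolding in_box_def z_def by blast
  (* The radius s carries absolute convergence, K < s the estimates for the increments. *)
  then obtain s where s: "\<bar>z\<bar> < s" "s < r" using dense by blast
  then obtain K where K: "\<bar>z\<bar> < K" "K < s" using dense by blast
  then have K0: "0 < K" by linarith
  obtain B where B: "B \<ge> 0"
    "\<And>k. real k * K ^ (k - Suc 0) \<le> B * s ^ k"
    "\<And>k. real k * real (k - Suc 0) * K ^ (k - 2) \<le> B * s ^ k"
    using derivative_coefficients_bounded[OF K0 K(2)] by blast
  define m where "m = (\<lambda>\<alpha>. c \<alpha> * mpow_rest p R \<alpha>)"
  have sum_f: "((\<lambda>\<alpha>. m \<alpha> * (z + t) ^ \<alpha> p) has_sum f (shift_entry p t R)) UNIV"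
    if "\<bar>z + t\<bar> < r" for t
    using has_seriesD[OF f in_box_shift[OF R, of p t]] that
    by (simp add: z_def m_def mpow_shift mult.assoc)
  have "(\<lambda>\<alpha>. m \<alpha> * s ^ \<alpha> p) summable_on UNIV"
    using sum_f[of "s - z"] s by (auto dest: has_sum_imp_summable)
  then have abs_m: "(\<lambda>\<alpha>. norm (m \<alpha> * s ^ \<alpha> p)) summable_on UNIV"
    by (rule summable_on_iff_abs_summable_on_real[THEN iffD1])
  have dominated: "(\<lambda>\<alpha>. m \<alpha> * g (\<alpha> p)) summable_on UNIV"
    if g: "\<And>k. \<bar>g k\<bar> \<le> B * s ^ k" for g :: "nat \<Rightarrow> real"
  proof (rule abs_summable_summable, rule summable_on_comparison_test)
    show "(\<lambda>\<alpha>. B * norm (m \<alpha> * s ^ \<alpha> p)) summable_on UNIV"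
      by (rule summable_on_cmult_right[OF abs_m])
    show "norm (m \<alpha> * g (\<alpha> p)) \<le> B * norm (m \<alpha> * s ^ \<alpha> p)" for \<alpha>
      using mult_left_mono[OF g[of "\<alpha> p"], of "\<bar>m \<alpha>\<bar>"] s
      by (simp add: abs_mult mult_ac)
  qed auto
  have "\<bar>real k * z ^ (k - Suc 0)\<bar> \<le> B * s ^ k" for k
  proof -
    have "\<bar>real k * z ^ (k - Suc 0)\<bar> \<le> real k * K ^ (k - Suc 0)"
      using K by (auto simp: abs_mult power_abs intro!: mult_left_mono power_mono)
    with B(2)[of k] show ?thesis by linarith
  qed
  from dominated[OF this] obtain D
    where D: "((\<lambda>\<alpha>. m \<alpha> * (real (\<alpha> p) * z ^ (\<alpha> p - Suc 0))) has_sum D) UNIV"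
    using has_sum_infsum by blast
  define g where "g = (\<lambda>k. real k * real (k - Suc 0) * K ^ (k - 2))"
  have g0: "g k \<ge> 0" for k using K0 by (simp add: g_def)
  have "(\<lambda>\<alpha>. m \<alpha> * g (\<alpha> p)) summable_on UNIV"
    using B(3) g0 by (intro dominated) (simp add: g_def)
  then have "(\<lambda>\<alpha>. norm (m \<alpha> * g (\<alpha> p))) summable_on UNIV"
    by (rule summable_on_iff_abs_summable_on_real[THEN iffD1])
  then obtain S where S: "((\<lambda>\<alpha>. norm (m \<alpha> * g (\<alpha> p))) has_sum S) UNIV"
    using has_sum_infsum by blast
  have bound: "norm ((f (shift_entry p h R) - f (shift_entry p 0 R)) / h - D) \<le> S * norm h"
    if h: "h \<noteq> 0" "norm h < K - \<bar>z\<bar>" for h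
  proof -
    have zh: "\<bar>z + h\<bar> \<le> K" using h by auto
    have "((\<lambda>\<alpha>. (m \<alpha> * (z + h) ^ \<alpha> p + - (m \<alpha> * (z + 0) ^ \<alpha> p)) * (1 / h)
        + - (m \<alpha> * (real (\<alpha> p) * z ^ (\<alpha> p - Suc 0)))) has_sum
        (f (shift_entry p h R) + - f (shift_entry p 0 R)) * (1 / h) + - D) UNIV"
      using zh K s by (intro has_sum_add has_sum_cmult_left has_sum_uminusI sum_f D) auto
    then have "((\<lambda>\<alpha>. m \<alpha> * (((z + h) ^ \<alpha> p - z ^ \<alpha> p) / h - real (\<alpha> p) * z ^ (\<alpha> p - Suc 0)))
        has_sum (f (shift_entry p h R) - f (shift_entry p 0 R)) / h - D) UNIV"
      by (simp add: algebra_simps diff_divide_distrib)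
    moreover have "((\<lambda>\<alpha>. norm (m \<alpha> * g (\<alpha> p)) * norm h) has_sum S * norm h) UNIV"
      by (rule has_sum_cmult_left[OF S])
    ultimately show ?thesis
    proof (rule norm_infsum_le)
      fix \<alpha>
      have "norm (((z + h) ^ \<alpha> p - z ^ \<alpha> p) / h - of_nat (\<alpha> p) * z ^ (\<alpha> p - Suc 0))
          \<le> g (\<alpha> p) * norm h"
        unfolding g_def using lemma_termdiff3[of h z K "\<alpha> p"] h K zh by simp
      then show "norm (m \<alpha> * (((z + h) ^ \<alpha> p - z ^ \<alpha> p) / h - real (\<alpha> p) * z ^ (\<alpha> p - Suc 0)))
          \<le> norm (m \<alpha> * g (\<alpha> p)) * norm h"
        using g0[of "\<alpha> p"] mult_left_mono[of _ "g (\<alpha> p) * norm h" "norm (m \<alpha>)"]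
        by (simp add: norm_mult mult.assoc abs_mult)
    qed
  qed
  have "((\<lambda>h. (f (shift_entry p h R) - f (shift_entry p 0 R)) / h - D) \<longlongrightarrow> 0) (at 0)"
  proof (rule Lim_null_comparison)
    have "eventually (\<lambda>h. h \<noteq> 0 \<and> norm h < K - \<bar>z\<bar>) (at (0::real))"
      using K by (auto simp: eventually_at dist_norm intro!: exI[of _ "K - \<bar>z\<bar>"])
    then show "\<forall>\<^sub>F h in at 0. norm ((f (shift_entry p h R) - f (shift_entry p 0 R)) / h - D)
        \<le> S * norm h"
      by eventually_elim (use bound in auto)
    show "((\<lambda>h. S * norm h) \<longlongrightarrow> 0) (at 0)"
      by (intro tendsto_eq_intros) auto
  qed
  then have "((\<lambda>t. f (shift_entry p t R)) has_real_derivative D) (at 0)"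
    unfolding DERIV_def by (subst Lim_null) simp
  then show ?thesis
    using D by (auto simp: m_def z_def mult.assoc)
qed

lemma has_series_partial_deriv:
  assumes f: "has_series r c f"
  shows "has_series r (\<lambda>\<alpha>. real (Suc (\<alpha> p)) * c (\<alpha> + unit_index p)) (partial_deriv (fst p) (snd p) f)"
  unfolding has_series_def
proof (intro allI impI)
  fix R :: "real^'a^'a" assume R: "in_box r R"
  let ?F = "\<lambda>\<alpha>. c \<alpha> * (mpow_rest p R \<alpha> * (real (\<alpha> p) * entry R p ^ (\<alpha> p - Suc 0)))"
  obtain D where D: "((\<lambda>t. f (shift_entry p t R)) has_real_derivative D) (at 0)" "(?F has_sum D) UNIV"
    using has_series_derivative[OF f R] by blast
  have inj: "inj (\<lambda>\<beta>. \<beta> + unit_index p)"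
    by (auto simp: inj_def)
  have "?F \<alpha> = 0" if "\<alpha> \<notin> range (\<lambda>\<beta>. \<beta> + unit_index p)" for \<alpha>
  proof -
    have "\<alpha> p = 0"
    proof (rule ccontr)
      assume "\<alpha> p \<noteq> 0"
      then have "\<alpha> = (\<lambda>q. \<alpha> q - unit_index p q) + unit_index p"
        by (auto simp: unit_index_def fun_eq_iff)
      with that show False by blast
    qed
    then show ?thesis by simp
  qed
  then have "(?F has_sum D) (range (\<lambda>\<beta>. \<beta> + unit_index p))"
    using D(2) by (subst has_sum_cong_neutral[where T = UNIV and g = ?F]) auto
  then have sum: "((?F \<circ> (\<lambda>\<beta>. \<beta> + unit_index p)) has_sum D) UNIV"
    using has_sum_reindex[OF inj] by blast
  have "mpow_rest p R (\<beta> + unit_index p) = mpow_rest p R \<beta>" for \<beta>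
    unfolding mpow_rest_def by (intro prod.cong) (auto simp: unit_index_def)
  then have "(?F \<circ> (\<lambda>\<beta>. \<beta> + unit_index p)) =
      (\<lambda>\<beta>. real (Suc (\<beta> p)) * c (\<beta> + unit_index p) * mpow R \<beta>)"
    by (auto simp: fun_eq_iff mpow_split[of R _ p] unit_index_def)
  moreover have "partial_deriv (fst p) (snd p) f R = D"
    using D(1) by (simp add: partial_deriv_shift DERIV_imp_deriv)
  ultimately show "((\<lambda>\<alpha>. real (Suc (\<alpha> p)) * c (\<alpha> + unit_index p) * mpow R \<alpha>) has_sum
      partial_deriv (fst p) (snd p) f R) UNIV"
    using sum by simp
qed

section \<open>Iterated derivatives at 0 and coefficients\<close>

text \<open>
  The coefficient formula depends on the list of derivatives only through the number of times each
  coordinate occurs, so the order of the derivatives is immaterial.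
\<close>

lemma has_series_iterated_deriv:
  assumes f: "has_series r c f"
  shows "has_series r
    (\<lambda>\<alpha>. (\<Prod>q\<in>UNIV. fact (\<alpha> q + count_list ps q) / fact (\<alpha> q)) * c (\<alpha> + count_list ps))
    (foldr (\<lambda>p. partial_deriv (fst p) (snd p)) ps f)"
proof (induction ps)
  case Nil
  have "\<alpha> + count_list [] = \<alpha>" for \<alpha> :: "'a \<times> 'a \<Rightarrow> nat"
    by (simp add: fun_eq_iff)
  then show ?case using f by simp
next
  case (Cons p ps)
  have "real (Suc (\<alpha> p)) * ((\<Prod>q\<in>UNIV. fact ((\<alpha> + unit_index p) q + count_list ps q) /
        fact ((\<alpha> + unit_index p) q)) * c (\<alpha> + unit_index p + count_list ps)) =
      (\<Prod>q\<in>UNIV. fact (\<alpha> q + count_list (p # ps) q) / fact (\<alpha> q)) * c (\<alpha> + count_list (p # ps))"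
    for \<alpha>
  proof -
    have "\<alpha> + unit_index p + count_list ps = \<alpha> + count_list (p # ps)"
      by (auto simp: fun_eq_iff unit_index_def)
    moreover have "(\<Prod>q\<in>UNIV - {p}. fact ((\<alpha> + unit_index p) q + count_list ps q) /
        fact ((\<alpha> + unit_index p) q)) =
      (\<Prod>q\<in>UNIV - {p}. fact (\<alpha> q + count_list (p # ps) q) / fact (\<alpha> q) :: real)"
      by (intro prod.cong) (auto simp: unit_index_def)
    ultimately show ?thesis
      by (simp add: prod.remove[of UNIV p] unit_index_def)
  qed
  with has_series_partial_deriv[OF Cons.IH, of p] show ?case
    by (simp only: foldr_Cons o_apply)
qed

lemma count_list_concat_map:
  "count_list (concat (map g xs)) y = (\<Sum>z\<leftarrow>xs. count_list (g z) y)"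
  by (induction xs) auto

lemma count_list_replicate: "count_list (replicate k z) y = (if z = y then k else 0)"
  by (induction k) auto

lemma foldr_concat_map: "foldr g (concat (map h xs)) f = foldr (\<lambda>z. foldr g (h z)) xs f"
  by (induction xs) auto

lemma foldr_replicate_funpow: "foldr g (replicate k z) = g z ^^ k"
  by (induction k) auto

text \<open>
  Flattening the nested iteration to one list of coordinates makes induction on the derivative possible.
\<close>

lemma multi_deriv_eq_iterated:
  fixes x :: "'n::{finite,linorder} \<Rightarrow> 'n \<Rightarrow> nat"
  obtains ps where "\<And>p. count_list ps p = x (fst p) (snd p)"
    "\<And>f. multi_deriv x f = foldr (\<lambda>p. partial_deriv (fst p) (snd p)) ps f"
proof -
  define E where "E = sorted_list_of_set (UNIV :: 'n set)"
  define row where "row = (\<lambda>i. concat (map (\<lambda>j. replicate (x i j) (i, j)) E))"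
  have E: "distinct E" "set E = UNIV" by (simp_all add: E_def)
  show ?thesis
  proof
    fix p
    have "count_list (row i) p = (if i = fst p then x (fst p) (snd p) else 0)" for i
      using E by (cases p) (auto simp: row_def count_list_concat_map count_list_replicate sum_list_distinct_conv_sum_set)
    then show "count_list (concat (map row E)) p = x (fst p) (snd p)"
      using E by (simp add: count_list_concat_map sum_list_distinct_conv_sum_set)
  next
    fix f :: "real^('n::{finite,linorder})^('n::{finite,linorder}) \<Rightarrow> real"
    show "multi_deriv x f = foldr (\<lambda>p. partial_deriv (fst p) (snd p)) (concat (map row E)) f"
      by (simp add: multi_deriv_def Let_def E_def[symmetric] row_def
          foldr_concat_map[abs_def] foldr_replicate_funpow)
  qed
qed

lemma has_series_at_0:
  assumes "has_series r c f" "0 < r"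
  shows "f 0 = c 0"
proof -
  have "in_box r 0" using assms(2) by (simp add: in_box_def entry_def)
  from has_seriesD[OF assms(1) this] have "((\<lambda>\<alpha>. c \<alpha> * mpow 0 \<alpha>) has_sum f 0) UNIV" .
  moreover have "mpow 0 \<alpha> = 0" if "\<alpha> \<noteq> 0" for \<alpha> :: "'a \<times> 'a \<Rightarrow> nat"
  proof -
    from that obtain p where "\<alpha> p \<noteq> 0" by (auto simp: fun_eq_iff)
    then show ?thesis
      unfolding mpow_def
      by (intro prod_zero finite bexI[of _ p]) (simp_all add: entry_def)
  qed
  ultimately have "((\<lambda>\<alpha>. c \<alpha> * mpow 0 \<alpha>) has_sum f 0) {0}"
    by (subst has_sum_cong_neutral[where T = UNIV and g = "\<lambda>\<alpha>. c \<alpha> * mpow 0 \<alpha>"]) auto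
  then have "f 0 = c 0 * mpow 0 0"
    by (subst (asm) has_sum_finite_iff) auto
  then show ?thesis by simp
qed

lemma multi_deriv_at_0:
  fixes f :: "real^('n::{finite,linorder})^('n::{finite,linorder}) \<Rightarrow> real" and x :: "'n::{finite,linorder} \<Rightarrow> 'n \<Rightarrow> nat"
  assumes "has_series r c f" "0 < r"
  shows "multi_deriv x f 0 = (\<Prod>i\<in>UNIV. \<Prod>j\<in>UNIV. fact (x i j)) * c (\<lambda>p. x (fst p) (snd p))"
proof -
  obtain ps where ps: "\<And>p. count_list ps p = x (fst p) (snd p)"
    "\<And>f. multi_deriv x f = foldr (\<lambda>p. partial_deriv (fst p) (snd p)) ps f"
    using multi_deriv_eq_iterated[of x] by blast
  have count: "count_list ps = (\<lambda>p. x (fst p) (snd p))"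
    using ps(1) by (rule ext)
  have "(\<Prod>i\<in>UNIV. \<Prod>j\<in>UNIV. fact (x i j)) = (\<Prod>q\<in>UNIV. fact (x (fst q) (snd q)) :: real)"
    by (simp add: prod.cartesian_product case_prod_beta)
  then show ?thesis
    using has_series_at_0[OF has_series_iterated_deriv[OF assms(1), of ps] assms(2)]
    by (simp add: ps(2) count)
qed

text \<open>
  The points that the derivative of multi-index \<open>\<alpha>\<close> at 0 can see.
\<close>

definition on_slice :: "('n \<times> 'n \<Rightarrow> nat) \<Rightarrow> real^'n^'n \<Rightarrow> bool" where
  "on_slice \<alpha> R \<longleftrightarrow> (\<forall>p. \<alpha> p = 0 \<longrightarrow> entry R p = 0)"

lemma iterated_deriv_cong_on_slice:
  assumes "\<And>R. in_box s R \<Longrightarrow> on_slice \<alpha> R \<Longrightarrow> f R = g R"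
    and "\<And>p. p \<in> set ps \<Longrightarrow> \<alpha> p \<noteq> 0"
    and "in_box s R" "on_slice \<alpha> R"
  shows "foldr (\<lambda>p. partial_deriv (fst p) (snd p)) ps f R =
    foldr (\<lambda>p. partial_deriv (fst p) (snd p)) ps g R"
  using assms(2-)
proof (induction ps arbitrary: R)
  case Nil
  then show ?case using assms(1) by simp
next
  case (Cons p ps)
  define F where "F = foldr (\<lambda>p. partial_deriv (fst p) (snd p)) ps f"
  define G where "G = foldr (\<lambda>p. partial_deriv (fst p) (snd p)) ps g"
  define \<delta> where "\<delta> = s - \<bar>entry R p\<bar>"
  have "\<delta> > 0" using Cons.prems(2) unfolding in_box_def \<delta>_def by (metis diff_gt_0_iff_gt)
  then have "eventually (\<lambda>t. \<bar>t\<bar> < \<delta>) (nhds (0::real))"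
    by (auto simp: eventually_nhds_metric dist_norm)
  then have "eventually (\<lambda>t. F (shift_entry p t R) = G (shift_entry p t R)) (nhds 0)"
    unfolding F_def G_def
  proof eventually_elim
    case (elim t)
    show ?case
    proof (rule Cons.IH)
      show "in_box s (shift_entry p t R)"
        using elim by (intro in_box_shift Cons.prems) (auto simp: \<delta>_def)
      show "on_slice \<alpha> (shift_entry p t R)"
        using Cons.prems(1)[of p] Cons.prems(3) by (auto simp: on_slice_def entry_shift)
    qed (use Cons.prems in auto)
  qed
  then have "partial_deriv (fst p) (snd p) F R = partial_deriv (fst p) (snd p) G R"
    unfolding partial_deriv_shift by (rule deriv_cong_ev) simp
  then show ?case by (simp add: F_def G_def)
qed

lemma multi_deriv_cong_on_slice:
  fixes f g :: "real^('n::{finite,linorder})^('n::{finite,linorder}) \<Rightarrow> real" and x :: "'n::{finite,linorder} \<Rightarrow> 'n \<Rightarrow> nat"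
  assumes "\<And>R. in_box s R \<Longrightarrow> on_slice (\<lambda>p. x (fst p) (snd p)) R \<Longrightarrow> f R = g R" and "0 < s"
  shows "multi_deriv x f 0 = multi_deriv x g 0"
proof -
  obtain ps where ps: "\<And>p. count_list ps p = x (fst p) (snd p)"
    "\<And>f. multi_deriv x f = foldr (\<lambda>p. partial_deriv (fst p) (snd p)) ps f"
    using multi_deriv_eq_iterated[of x] by blast
  have "x (fst p) (snd p) \<noteq> 0" if "p \<in> set ps" for p
    using that ps(1)[of p] by (metis count_list_0_iff)
  moreover have "in_box s 0" "on_slice \<alpha> 0" for \<alpha> :: "'n \<times> 'n \<Rightarrow> nat"
    using assms(2) by (simp_all add: in_box_def on_slice_def entry_def)
  ultimately show ?thesis
    unfolding ps(2) by (intro iterated_deriv_cong_on_slice[OF assms(1)]) auto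
qed

text \<open>
  Uniqueness of coefficients, in the sharp form that only needs agreement on the slice of \<open>\<alpha>\<close>.
\<close>

lemma coefficient_eq_on_slice:
  fixes f g :: "real^('n::{finite,linorder})^('n::{finite,linorder}) \<Rightarrow> real" and \<alpha> :: "'n::{finite,linorder} \<times> 'n \<Rightarrow> nat"
  assumes "has_series r c f" "has_series r d g" "0 < r"
    and "\<And>R. in_box r R \<Longrightarrow> on_slice \<alpha> R \<Longrightarrow> f R = g R"
  shows "c \<alpha> = d \<alpha>"
proof -
  define x where "x = (\<lambda>i j. \<alpha> (i, j))"
  have \<alpha>: "(\<lambda>p. x (fst p) (snd p)) = \<alpha>" by (simp add: x_def)
  have "multi_deriv x f 0 = multi_deriv x g 0"
    using assms by (intro multi_deriv_cong_on_slice[of r]) (auto simp: \<alpha>)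
  then show ?thesis
    using assms by (simp add: multi_deriv_at_0 \<alpha>)
qed

section \<open>Determinants of power series\<close>

lemma has_sum_finite_sum:
  fixes f :: "'i \<Rightarrow> 'a \<Rightarrow> real"
  assumes "\<And>i. i \<in> F \<Longrightarrow> (f i has_sum s i) A"
  shows "((\<lambda>a. \<Sum>i\<in>F. f i a) has_sum (\<Sum>i\<in>F. s i)) A"
  using assms by (induction F rule: infinite_finite_induct) (auto intro!: has_sum_add)

lemma has_sum_finite_prod:
  fixes g :: "'p \<Rightarrow> 'a \<Rightarrow> real"
  assumes "finite S" "\<And>p. p \<in> S \<Longrightarrow> (g p has_sum s p) UNIV"
  shows "((\<lambda>A. \<Prod>p\<in>S. g p (A p)) has_sum (\<Prod>p\<in>S. s p)) (PiE S (\<lambda>_. UNIV))"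
  using assms
proof (induction S rule: finite_induct)
  case empty
  show ?case by (rule has_sum_finiteI) auto
next
  case (insert p S)
  define j where "j = (\<lambda>(a, A). A(p := a) :: 'p \<Rightarrow> 'a)"
  have inj: "inj_on j (UNIV \<times> PiE S (\<lambda>_. UNIV))"
    unfolding j_def by (rule inj_combinator[of p S "\<lambda>_. UNIV"]) (use insert in auto)
  have img: "PiE (insert p S) (\<lambda>_. UNIV) = j ` (UNIV \<times> PiE S (\<lambda>_. UNIV))"
    unfolding j_def by (rule PiE_insert_eq)
  have eq: "(\<Prod>q\<in>insert p S. g q (j (a, A) q)) = g p a * (\<Prod>q\<in>S. g q (A q))" for a A
    using insert by (auto simp: j_def intro!: prod.cong)
  have "((\<lambda>(a, A). g p a * (\<Prod>q\<in>S. g q (A q))) has_sum s p * (\<Prod>p\<in>S. s p))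
      (UNIV \<times> PiE S (\<lambda>_. UNIV))"
    by (rule has_sum_mult_real) (use insert in auto)
  moreover have "(\<lambda>A. \<Prod>q\<in>insert p S. g q (A q)) \<circ> j = (\<lambda>(a, A). g p a * (\<Prod>q\<in>S. g q (A q)))"
    using eq by (auto simp: fun_eq_iff simp del: prod.insert)
  ultimately show ?case
    unfolding img has_sum_reindex[OF inj] using insert by simp
qed

lemma has_series_exists_prod:
  assumes "\<And>a. a \<in> S \<Longrightarrow> \<exists>c. has_series r c (f a)"
  shows "\<exists>c. has_series r c (\<lambda>R. \<Prod>a\<in>S. f a R)"
  using assms
proof (induction S rule: infinite_finite_induct)
  case (insert a S)
  then obtain d where d: "has_series r d (\<lambda>R. \<Prod>a\<in>S. f a R)" by blast
  obtain c where "has_series r c (f a)" using insert.prems by blast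
  from has_series_mult[OF this d] insert.hyps show ?case by auto
qed (auto intro: has_series_const)

lemma has_series_exists_power:
  assumes "has_series r c f"
  shows "\<exists>d. has_series r d (\<lambda>R. f R ^ k)"
  using has_series_exists_prod[of "{..<k}" r "\<lambda>_. f"] assms by auto

lemma has_series_exists_diff:
  assumes "has_series r c f" "has_series r d g"
  shows "\<exists>e. has_series r e (\<lambda>R. f R - g R)"
  using has_series_add[OF assms(1) has_series_cmult[OF assms(2), of "-1"]] by auto

lemma has_series_exists_det:
  fixes A :: "real^'n^'n \<Rightarrow> real^'p^'p"
  assumes "\<And>p q. \<exists>c. has_series r c (\<lambda>R. A R $ p $ q)"
  shows "\<exists>c. has_series r c (\<lambda>R. det (A R))"
proof -
  have "\<exists>c. has_series r c (\<lambda>R. of_int (sign \<sigma>) * (\<Prod>p\<in>UNIV. A R $ p $ \<sigma> p))" for \<sigma>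
  proof -
    have "\<exists>c. has_series r c (\<lambda>R. \<Prod>p\<in>UNIV. A R $ p $ \<sigma> p)"
      by (rule has_series_exists_prod) (rule assms)
    then obtain c where c: "has_series r c (\<lambda>R. \<Prod>p\<in>UNIV. A R $ p $ \<sigma> p)" ..
    show ?thesis by (rule exI, rule has_series_cmult, rule c)
  qed
  then obtain c where "\<And>\<sigma>. has_series r (c \<sigma>) (\<lambda>R. of_int (sign \<sigma>) * (\<Prod>p\<in>UNIV. A R $ p $ \<sigma> p))"
    using choice[of "\<lambda>\<sigma> c. has_series r c (\<lambda>R. of_int (sign \<sigma>) * (\<Prod>p\<in>UNIV. A R $ p $ \<sigma> p))"]
    by auto
  then have "has_series r (\<lambda>\<alpha>. \<Sum>\<sigma> | \<sigma> permutes UNIV. c \<sigma> \<alpha>) (\<lambda>R. det (A R))"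
    unfolding det_def by (intro has_series_sum) auto
  then show ?thesis by blast
qed

section \<open>Good's determinant identity\<close>

text \<open>
  The Euler operator of a coordinate acts on monomials as multiplication by the exponent. This is what
  turns the differential determinant of Good's formula into determinants of numbers.
\<close>

lemma has_series_euler:
  assumes "has_series r c f"
  shows "has_series r (\<lambda>\<alpha>. real (\<alpha> p) * c \<alpha>) (\<lambda>R. entry R p * partial_deriv (fst p) (snd p) f R)"
  unfolding has_series_def
proof (intro allI impI)
  fix R :: "real^'a^'a" assume R: "in_box r R"
  obtain D where D: "((\<lambda>t. f (shift_entry p t R)) has_real_derivative D) (at 0)"
    "((\<lambda>\<alpha>. c \<alpha> * (mpow_rest p R \<alpha> * (real (\<alpha> p) * entry R p ^ (\<alpha> p - Suc 0)))) has_sum D) UNIV"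
    using has_series_derivative[OF assms R] by blast
  have "entry R p * (c \<alpha> * (mpow_rest p R \<alpha> * (real (\<alpha> p) * entry R p ^ (\<alpha> p - Suc 0)))) =
      real (\<alpha> p) * c \<alpha> * mpow R \<alpha>" (is "?l \<alpha> = _") for \<alpha>
    by (cases "\<alpha> p") (simp_all add: mpow_split[of R _ p])
  moreover have "partial_deriv (fst p) (snd p) f R = D"
    using D(1) by (simp add: partial_deriv_shift DERIV_imp_deriv)
  ultimately show "((\<lambda>\<alpha>. real (\<alpha> p) * c \<alpha> * mpow R \<alpha>) has_sum
      entry R p * partial_deriv (fst p) (snd p) f R) UNIV"
    using has_sum_cmult_right[OF D(2), of "entry R p"] by (simp only:)
qed

lemma partial_deriv_power:
  assumes "has_series r c f" "in_box r R"
  shows "partial_deriv (fst p) (snd p) (\<lambda>R. f R ^ k) R =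
    real k * f R ^ (k - 1) * partial_deriv (fst p) (snd p) f R"
proof -
  obtain D where D: "((\<lambda>t. f (shift_entry p t R)) has_real_derivative D) (at 0)"
    using has_series_derivative[OF assms] by blast
  have "shift_entry p 0 R = R" by (simp add: shift_entry_def)
  then have "((\<lambda>t. f (shift_entry p t R) ^ k) has_real_derivative real k * f R ^ (k - 1) * D) (at 0)"
    using DERIV_power[OF D, of k] by (simp add: mult_ac)
  then show ?thesis using D by (simp add: partial_deriv_shift DERIV_imp_deriv)
qed

text \<open>
  For nonzero \<open>u\<close> this is conjugation by the diagonal matrix of \<open>u\<close>. It holds for all \<open>u\<close> because
  the two Leibniz expansions agree term by term: a permutation maps the set of its non-fixed points onto
  itself, so both terms contain the product of \<open>u\<close> over that set.
\<close>

lemma det_diag_minus_scaled_rows_eq_scaled_columns: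
  fixes a u :: "'p::finite \<Rightarrow> real"
  shows "det (\<chi> p q. (if p = q then a p else 0) - u p * b p q) =
    det (\<chi> p q. (if p = q then a p else 0) - u q * b p q)"
proof -
  have "(\<Prod>p\<in>UNIV. (if p = \<sigma> p then a p else 0) - u p * b p (\<sigma> p)) =
      (\<Prod>p\<in>UNIV. (if p = \<sigma> p then a p else 0) - u (\<sigma> p) * b p (\<sigma> p))"
    if \<sigma>: "\<sigma> permutes UNIV" for \<sigma>
  proof -
    define N where "N = {p. \<sigma> p \<noteq> p}"
    have "bij_betw \<sigma> N N"
      using permutes_inverses[OF \<sigma>] by (intro bij_betwI[where g = "inv \<sigma>"]) (auto simp: N_def, metis+)
    then have u: "(\<Prod>p\<in>N. u (\<sigma> p)) = (\<Prod>p\<in>N. u p)"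
      by (rule prod.reindex_bij_betw)
    have "(\<Prod>p\<in>UNIV. (if p = \<sigma> p then a p else 0) - w p * b p (\<sigma> p)) =
        (\<Prod>p\<in>-N. a p - w p * b p p) * ((\<Prod>p\<in>N. w p) * (\<Prod>p\<in>N. - b p (\<sigma> p)))" for w
    proof -
      have "(\<Prod>p\<in>UNIV. (if p = \<sigma> p then a p else 0) - w p * b p (\<sigma> p)) =
          (\<Prod>p\<in>-N. (if p = \<sigma> p then a p else 0) - w p * b p (\<sigma> p)) *
          (\<Prod>p\<in>N. (if p = \<sigma> p then a p else 0) - w p * b p (\<sigma> p))"
        by (subst prod.union_disjoint[symmetric]) (auto simp: Un_commute)
      also have "\<dots> = (\<Prod>p\<in>-N. a p - w p * b p p) * (\<Prod>p\<in>N. w p * - b p (\<sigma> p))"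
        by (intro arg_cong2[where f = "(*)"] prod.cong) (auto simp: N_def)
      finally show ?thesis by (simp only: prod.distrib)
    qed
    from this[of u] this[of "\<lambda>p. u (\<sigma> p)"] show ?thesis
      by (simp add: u) (auto intro!: prod.cong simp: N_def)
  qed
  then show ?thesis
    unfolding det_def by (intro sum.cong refl arg_cong2[where f = "(*)"]) auto
qed

text \<open>
  This is \<open>I - \<Gamma>\<close> with row \<open>p\<close> multiplied by \<open>f p R ^ x p\<close> and the denominator \<open>f p R\<close> cancelled. A row with
  \<open>x p = 0\<close> has no factor to cancel against and is replaced by its value at \<open>R\<^sub>p = 0\<close>, a unit vector.
\<close>

definition good_matrix ::
  "('n \<times> 'n \<Rightarrow> real^'n^'n \<Rightarrow> real) \<Rightarrow> ('n \<times> 'n \<Rightarrow> nat) \<Rightarrow> real^'n^'n \<Rightarrow> real^('n \<times> 'n)^('n \<times> 'n)" where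
  "good_matrix f x R = (\<chi> p q.
     if x p = 0 then (if p = q then 1 else 0)
     else f p R ^ (x p - 1) * ((if p = q then f p R else 0) -
       entry R p * partial_deriv (fst q) (snd q) (f p) R))"

lemma has_series_good_det:
  assumes "\<And>p. has_series r (c p) (f p)"
  shows "\<exists>d. has_series r d (\<lambda>R. det (good_matrix f x R))"
proof (rule has_series_exists_det)
  fix p q
  obtain d1 where d1: "has_series r d1 (\<lambda>R. f p R ^ (x p - 1))"
    using has_series_exists_power[OF assms] by blast
  obtain d2 where "has_series r d2 (\<lambda>R. (if p = q then 1 else 0) * f p R -
      entry R p * partial_deriv (fst q) (snd q) (f p) R)"
    using has_series_exists_diff[OF has_series_cmult[OF assms]
        has_series_mult[OF has_series_entry has_series_partial_deriv[OF assms]]] by blast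
  from has_series_mult[OF d1 this]
  have "\<exists>d. has_series r d (\<lambda>R. f p R ^ (x p - 1) * ((if p = q then f p R else 0) -
      entry R p * partial_deriv (fst q) (snd q) (f p) R))"
    by (auto simp: if_distrib[of "\<lambda>z. z * _"] cong: if_cong)
  then show "\<exists>d. has_series r d (\<lambda>R. good_matrix f x R $ p $ q)"
    using has_series_const[of r "if p = q then 1 else 0"]
    by (cases "x p = 0") (auto simp: good_matrix_def)
qed

text \<open>
  If row \<open>p\<close> is expanded with exponent \<open>B p\<close>, every term of the Leibniz formula carries the same total exponent
  \<open>\<Sum>p. B p\<close>; the signs and products then recombine to a determinant of coefficients.
\<close>

lemma has_series_det:
  fixes A :: "real^'n^'n \<Rightarrow> real^('n \<times> 'n)^('n \<times> 'n)"
  assumes "\<And>p q. has_series r (k p q) (\<lambda>R. A R $ p $ q)"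
  shows "has_series r (\<lambda>\<alpha>. \<Sum>B | B \<in> UNIV \<and> sum B UNIV = \<alpha>. det (\<chi> p q. k p q (B p))) (\<lambda>R. det (A R))"
proof (rule has_series_regroup)
  fix \<alpha> :: "'n \<times> 'n \<Rightarrow> nat"
  have le: "B p q \<le> \<alpha> q" if "sum B UNIV = \<alpha>" for B :: "'n \<times> 'n \<Rightarrow> 'n \<times> 'n \<Rightarrow> nat" and p q
  proof -
    have "B p q \<le> (\<Sum>p\<in>UNIV. B p q)" using member_le_sum[of p UNIV "\<lambda>p. B p q"] by simp
    also have "\<dots> = sum B UNIV q" by (rule sum_fun_apply[symmetric])
    also have "\<dots> = \<alpha> q" by (simp only: that)
    finally show ?thesis .
  qed
  have "{B \<in> (UNIV :: ('n \<times> 'n \<Rightarrow> 'n \<times> 'n \<Rightarrow> nat) set). sum B UNIV = \<alpha>} \<subseteq> PiE UNIV (\<lambda>_. {\<beta>. \<forall>q. \<beta> q \<le> \<alpha> q})"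
  proof
    fix B :: "'n \<times> 'n \<Rightarrow> 'n \<times> 'n \<Rightarrow> nat" assume "B \<in> {B \<in> UNIV. sum B UNIV = \<alpha>}"
    then have "\<forall>p q. B p q \<le> \<alpha> q" using le by blast
    then show "B \<in> PiE UNIV (\<lambda>_. {\<beta>. \<forall>q. \<beta> q \<le> \<alpha> q})"
      unfolding PiE_UNIV_domain Pi_def by blast
  qed
  then show "finite {B \<in> (UNIV :: ('n \<times> 'n \<Rightarrow> 'n \<times> 'n \<Rightarrow> nat) set). sum B UNIV = \<alpha>}"
    by (rule finite_subset) (intro finite_PiE finite finite_index_le)
next
  fix R :: "real^'n^'n" assume R: "in_box r R"
  have "((\<lambda>B. \<Sum>\<sigma> | \<sigma> permutes UNIV. of_int (sign \<sigma>) *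
        (\<Prod>p\<in>UNIV. k p (\<sigma> p) (B p) * mpow R (B p))) has_sum det (A R)) UNIV"
    unfolding det_def
  proof (intro has_sum_finite_sum has_sum_cmult_right)
    fix \<sigma> :: "'n \<times> 'n \<Rightarrow> 'n \<times> 'n"
    have "((\<lambda>B. \<Prod>p\<in>UNIV. k p (\<sigma> p) (B p) * mpow R (B p)) has_sum (\<Prod>p\<in>UNIV. A R $ p $ \<sigma> p))
        (PiE UNIV (\<lambda>_. UNIV))"
      by (rule has_sum_finite_prod) (auto intro: has_seriesD[OF assms R])
    then show "((\<lambda>B. \<Prod>p\<in>UNIV. k p (\<sigma> p) (B p) * mpow R (B p)) has_sum
        (\<Prod>p\<in>UNIV. A R $ p $ \<sigma> p)) UNIV"
      by simp
  qed
  moreover have "(\<Sum>\<sigma> | \<sigma> permutes UNIV. of_int (sign \<sigma>) *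
        (\<Prod>p\<in>UNIV. k p (\<sigma> p) (B p) * mpow R (B p))) =
      det (\<chi> p q. k p q (B p)) * mpow R (sum B UNIV)" for B
    by (simp add: det_def mpow_sum prod.distrib sum_distrib_right mult.assoc)
  ultimately show "((\<lambda>B. det (\<chi> p q. k p q (B p)) * mpow R (sum B UNIV)) has_sum det (A R)) UNIV"
    by simp
qed

text \<open>
  The rows with \<open>x p \<noteq> 0\<close> sum to 0. Column \<open>q\<close> of their sum is \<open>x q\<close> minus column sum \<open>q\<close> of \<open>B\<close>,
  since the rows of \<open>B\<close> with \<open>x p = 0\<close> vanish. The diagonal entry 1 for \<open>x p = 0\<close> stands for the unit row of
  \<open>good_matrix\<close>.
\<close>

lemma index_det_eq_0:
  fixes x :: "'p::finite \<Rightarrow> nat" and B :: "'p \<Rightarrow> 'p \<Rightarrow> nat"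
  assumes "sum B UNIV = x" "x \<noteq> 0" and B0: "\<And>p. x p = 0 \<Longrightarrow> B p = 0"
  shows "det (\<chi> p q. (if p = q then real (if x p = 0 then 1 else x p) else 0) - real (B p q)) = 0"
    (is "det ?K = 0")
proof (rule ccontr)
  (* The indicator vector of the rows that sum to 0. *)
  define v :: "real^'p" where "v = (\<chi> p. if x p = 0 then 0 else 1)"
  assume "det ?K \<noteq> 0"
  then have "invertible (transpose ?K)"
    by (simp add: invertible_det_nz)
  moreover have "transpose ?K *v v = 0"
    unfolding vec_eq_iff
  proof (intro allI)
    fix q
    have "(\<Sum>p\<in>UNIV. real (B p q) * v $ p) = (\<Sum>p\<in>UNIV. real (B p q))"
      by (intro sum.cong) (auto simp: v_def B0)
    also have "\<dots> = real (x q)"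
      unfolding assms(1)[symmetric] sum_fun_apply by simp
    finally show "(transpose ?K *v v) $ q = 0 $ q"
      by (simp add: matrix_vector_mult_def transpose_def left_diff_distrib sum_subtractf
          if_distrib[of "\<lambda>z. z * _"] cong: if_cong) (simp add: v_def)
  qed
  ultimately have "v = 0"
    using matrix_left_invertible_ker[of "transpose ?K"] by (auto simp: invertible_left_inverse)
  then show False
    using assms(2) by (auto simp: v_def vec_eq_iff fun_eq_iff split: if_splits)
qed

text \<open>
  Good's identity. Multiplying row \<open>p\<close> by \<open>x p\<close> (by 1 if \<open>x p = 0\<close>) makes it a combination of \<open>h p = f p ^ x p\<close> and its
  derivatives, because \<open>x p * f p ^ (x p - 1)\<close> times a derivative of \<open>f p\<close> is that derivative of \<open>h p\<close>. After
  conjugation only Euler operators occur.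
\<close>

theorem good_det_coefficient_eq_0:
  fixes f :: "('n::{finite,linorder}) \<times> 'n \<Rightarrow> real^('n::{finite,linorder})^('n::{finite,linorder}) \<Rightarrow> real"
  assumes r: "0 < r" and f: "\<And>p. has_series r (c p) (f p)"
    and d: "has_series r d (\<lambda>R. det (good_matrix f x R))" and x: "x \<noteq> 0"
  shows "d x = 0"
proof -
  define y where "y = (\<lambda>p. real (if x p = 0 then 1 else x p))"
  have "\<exists>h. has_series r h (\<lambda>R. f p R ^ x p) \<and> (x p = 0 \<longrightarrow> h = (\<lambda>\<alpha>. if \<alpha> = 0 then 1 else 0))" for p
    using has_series_exists_power[OF f, of p "x p"] has_series_const[of r 1] by (cases "x p = 0") auto
  then obtain h where h: "\<And>p. has_series r (h p) (\<lambda>R. f p R ^ x p)"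
    and h0: "\<And>p. x p = 0 \<Longrightarrow> h p = (\<lambda>\<alpha>. if \<alpha> = 0 then 1 else 0)"
    by metis
  define k where "k = (\<lambda>p q \<alpha>. ((if p = q then y p else 0) - real (\<alpha> q)) * h p \<alpha>)"
  define A where "A = (\<lambda>R. \<chi> p q. (if p = q then y p * f p R ^ x p else 0) -
      entry R q * partial_deriv (fst q) (snd q) (\<lambda>R. f p R ^ x p) R)"
  have "has_series r (k p q) (\<lambda>R. A R $ p $ q)" for p q
    using has_series_add[OF has_series_cmult[OF h, of "if p = q then y p else 0" p]
        has_series_cmult[OF has_series_euler[OF h], of "-1" q p]]
    by (simp add: k_def A_def left_diff_distrib if_distrib[of "\<lambda>z. z * _"] cong: if_cong)
  then have A: "has_series r (\<lambda>\<alpha>. \<Sum>B | B \<in> UNIV \<and> sum B UNIV = \<alpha>. det (\<chi> p q. k p q (B p)))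
      (\<lambda>R. det (A R))"
    by (rule has_series_det)
  have det_A: "det (A R) = prod y UNIV * det (good_matrix f x R)" if R: "in_box r R" for R
  proof -
    define a where "a = (\<lambda>p. y p * f p R ^ x p)"
    define b where "b = (\<lambda>p q. partial_deriv (fst q) (snd q) (\<lambda>R. f p R ^ x p) R)"
    have b: "b p q = real (x p) * f p R ^ (x p - 1) * partial_deriv (fst q) (snd q) (f p) R" for p q
      unfolding b_def by (rule partial_deriv_power[OF f R])
    have "det (A R) = det (\<chi> p q. (if p = q then a p else 0) - entry R q * b p q)"
      by (simp add: A_def a_def b_def cong: if_cong)
    also have "\<dots> = det (\<chi> p q. (if p = q then a p else 0) - entry R p * b p q)"
      by (rule det_diag_minus_scaled_rows_eq_scaled_columns[symmetric])
    also have "(\<chi> p q. (if p = q then a p else 0) - entry R p * b p q) =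
        (\<chi> p. y p *s (good_matrix f x R $ p))"
      unfolding vec_eq_iff
    proof (intro allI)
      fix p q
      show "(\<chi> p q. (if p = q then a p else 0) - entry R p * b p q) $ p $ q =
          (\<chi> p. y p *s (good_matrix f x R $ p)) $ p $ q"
        by (cases "x p") (auto simp: a_def b good_matrix_def y_def algebra_simps)
    qed
    finally show ?thesis by (simp add: det_rows_mul)
  qed
  have "(\<Sum>B | B \<in> UNIV \<and> sum B UNIV = x. det (\<chi> p q. k p q (B p))) = prod y UNIV * d x"
    by (rule coefficient_eq_on_slice[OF A has_series_cmult[OF d] r det_A])
  moreover have "det (\<chi> p q. k p q (B p)) = 0" if B: "sum B UNIV = x" for B
  proof -
    have factor: "det (\<chi> p q. k p q (B p)) = (\<Prod>p\<in>UNIV. h p (B p)) *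
        det (\<chi> p q. (if p = q then y p else 0) - real (B p q))"
      by (simp add: k_def flip: det_rows_mul) (simp add: vector_scalar_mult_def mult.commute)
    show ?thesis
    (* If x p = 0 then h p is the constant 1, which has no monomial B p other than 0. *)
    proof (cases "\<exists>p. x p = 0 \<and> B p \<noteq> 0")
      case True
      then obtain p where "x p = 0" "B p \<noteq> 0" by blast
      then have "h p (B p) = 0" using h0[of p] by simp
      then have "(\<Prod>p\<in>UNIV. h p (B p)) = 0"
        by (intro prod_zero finite bexI[of _ p]) simp_all
      then show ?thesis by (simp add: factor)
    next
      case False
      then have "det (\<chi> p q. (if p = q then y p else 0) - real (B p q)) = 0"
        unfolding y_def by (intro index_det_eq_0[OF B x]) blast
      then show ?thesis by (simp add: factor)
    qed
  qed
  then have "(\<Sum>B | B \<in> UNIV \<and> sum B UNIV = x. det (\<chi> p q. k p q (B p))) = 0"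
    by (intro sum.neutral) blast
  moreover have "prod y UNIV \<noteq> 0"
    unfolding prod_zero_iff[OF finite] by (auto simp: y_def)
  ultimately show ?thesis by simp
qed

section \<open>The algebra of coefficients\<close>

lemma conv_sum_left: "conv (\<lambda>\<alpha>. \<Sum>a\<in>S. c a \<alpha>) d \<alpha> = (\<Sum>a\<in>S. conv (c a) d \<alpha>)"
  unfolding conv_def by (subst sum.swap) (simp add: sum_distrib_right)

lemma conv_sum_right: "conv c (\<lambda>\<alpha>. \<Sum>a\<in>S. d a \<alpha>) \<alpha> = (\<Sum>a\<in>S. conv c (d a) \<alpha>)"
  unfolding conv_def by (subst sum.swap) (simp add: sum_distrib_left)

lemma conv_cmult_left: "conv (\<lambda>\<alpha>. k * c \<alpha>) d \<alpha> = k * conv c d \<alpha>"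
  unfolding conv_def by (simp add: sum_distrib_left mult_ac)

lemma conv_cmult_right: "conv c (\<lambda>\<alpha>. k * d \<alpha>) \<alpha> = k * conv c d \<alpha>"
  unfolding conv_def by (simp add: sum_distrib_left mult_ac)

text \<open>
  Coefficients up to some degree of a product only involve coefficients up to that degree of the factors;
  this is how infinite series over the claim size get truncated.
\<close>

lemma conv_cong_degree:
  fixes \<alpha> :: "'v::finite \<Rightarrow> nat"
  assumes "\<And>\<beta>. sum \<beta> UNIV \<le> sum \<alpha> UNIV \<Longrightarrow> c \<beta> = c' \<beta>" "\<And>\<beta>. sum \<beta> UNIV \<le> sum \<alpha> UNIV \<Longrightarrow> d \<beta> = d' \<beta>"
  shows "conv c d \<alpha> = conv c' d' \<alpha>"
  unfolding conv_def
proof (rule sum.cong)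
  fix z :: "('v \<Rightarrow> nat) \<times> ('v \<Rightarrow> nat)" assume "z \<in> {z. fst z + snd z = \<alpha>}"
  then have "sum \<alpha> UNIV = sum (fst z) UNIV + sum (snd z) UNIV"
    by (auto simp: sum.distrib)
  then show "c (fst z) * d (snd z) = c' (fst z) * d' (snd z)"
    using assms by simp
qed simp

lemma conv_delta:
  "conv (\<lambda>\<beta>. if \<beta> = \<gamma> then k else 0) d (\<gamma> + \<alpha>) = k * d (\<alpha> :: 'v::finite \<Rightarrow> nat)"
proof -
  have "conv (\<lambda>\<beta>. if \<beta> = \<gamma> then k else 0) d (\<gamma> + \<alpha>) = (\<Sum>z\<in>{(\<gamma>, \<alpha>)}. k * d (snd z))"
    unfolding conv_def
  proof (rule sum.mono_neutral_cong_right[OF finite_index_splits])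
    show "{(\<gamma>, \<alpha>)} \<subseteq> {z. fst z + snd z = \<gamma> + \<alpha>}"
      unfolding insert_subset mem_Collect_eq fst_conv snd_conv by blast
    have "z = (\<gamma>, \<alpha>)" if "fst z + snd z = \<gamma> + \<alpha>" "fst z = \<gamma>" for z
      using that add_left_imp_eq[of \<gamma> "snd z" \<alpha>] by (cases z) auto
    then show "\<forall>z\<in>{z. fst z + snd z = \<gamma> + \<alpha>} - {(\<gamma>, \<alpha>)}.
        (if fst z = \<gamma> then k else 0) * d (snd z) = 0"
      by (metis (mono_tags, lifting) DiffD1 DiffD2 insertI1 mem_Collect_eq mult_zero_left)
  qed auto
  then show ?thesis by simp
qed

lemma conv_constant: "conv (\<lambda>\<alpha>. if \<alpha> = 0 then k else 0) d \<alpha> = k * d (\<alpha> :: 'v::finite \<Rightarrow> nat)"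
  using conv_delta[of 0 k d \<alpha>] unfolding add_0 .

lemma conv_entry_shifted:
  "conv (\<lambda>\<alpha>. if \<alpha> = unit_index p then 1 else 0) d (unit_index p + \<alpha>) = d (\<alpha> :: 'v::finite \<Rightarrow> nat)"
  using conv_delta[of "unit_index p" 1 d \<alpha>] unfolding mult_1 .

lemma conv_entry_eq_0:
  assumes "\<alpha> p = 0"
  shows "conv (\<lambda>\<alpha>. if \<alpha> = unit_index p then 1 else 0) d \<alpha> = 0"
  unfolding conv_def
proof (rule sum.neutral, rule)
  fix z assume "z \<in> {z. fst z + snd z = \<alpha>}"
  then have "fst z + snd z = \<alpha>" by simp
  then have "fst z p + snd z p = 0" using assms by (metis plus_fun_apply)
  then have "fst z \<noteq> unit_index p" by (auto simp: unit_index_def)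
  then show "(if fst z = unit_index p then 1 else 0) * d (snd z) = 0" by simp
qed

section \<open>Matrix powers and the claim transform as power series\<close>

text \<open>
  The coefficients count walks: \<open>matpow_coeff m i j \<alpha>\<close> is the number of walks of length \<open>m\<close> from \<open>i\<close> to \<open>j\<close>
  that use each pair \<open>p\<close> exactly \<open>\<alpha> p\<close> times.
\<close>

primrec matpow_coeff :: "nat \<Rightarrow> 'n::finite \<Rightarrow> 'n \<Rightarrow> ('n \<times> 'n \<Rightarrow> nat) \<Rightarrow> real" where
  "matpow_coeff 0 i j = (\<lambda>\<alpha>. if \<alpha> = 0 then (if i = j then 1 else 0) else 0)"
| "matpow_coeff (Suc m) i j =
     (\<lambda>\<alpha>. \<Sum>q\<in>UNIV. conv (\<lambda>\<alpha>. if \<alpha> = unit_index (i, q) then 1 else 0) (matpow_coeff m q j) \<alpha>)"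

lemma has_series_matpow: "has_series r (matpow_coeff m i j) (\<lambda>R. matpow R m $ i $ j)"
proof (induction m arbitrary: i)
  case 0
  show ?case using has_series_const[of r "if i = j then 1 else 0"] by (simp add: mat_def)
next
  case (Suc m)
  have "has_series r (\<lambda>\<alpha>. \<Sum>q\<in>UNIV. conv (\<lambda>\<alpha>. if \<alpha> = unit_index (i, q) then 1 else 0) (matpow_coeff m q j) \<alpha>)
      (\<lambda>R. \<Sum>q\<in>UNIV. entry R (i, q) * matpow R m $ q $ j)"
    by (intro has_series_sum has_series_mult has_series_entry Suc)
  then show ?case by (simp add: matrix_matrix_mult_def entry_def)
qed

lemma conv_nonneg: "(\<And>\<beta>. 0 \<le> c \<beta>) \<Longrightarrow> (\<And>\<beta>. 0 \<le> d \<beta>) \<Longrightarrow> 0 \<le> conv c d \<alpha>"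
  unfolding conv_def by (intro sum_nonneg mult_nonneg_nonneg)

lemma matpow_coeff_nonneg: "0 \<le> matpow_coeff m i j \<alpha>"
  by (induction m arbitrary: i \<alpha>) (auto intro!: sum_nonneg conv_nonneg)

lemma sum_unit_index: "sum (unit_index p) UNIV = (1 :: nat)" for p :: "'v::finite"
  by (simp add: unit_index_def)

lemma matpow_coeff_degree: "sum \<alpha> UNIV \<noteq> m \<Longrightarrow> matpow_coeff m i j \<alpha> = 0"
proof (induction m arbitrary: i \<alpha>)
  case 0
  then have "\<alpha> \<noteq> 0" by auto
  then show ?case by simp
next
  case (Suc m)
  have "conv (\<lambda>\<alpha>. if \<alpha> = unit_index (i, q) then 1 else 0) (matpow_coeff m q j) \<alpha> = 0" for q
    unfolding conv_def
  proof (rule sum.neutral, rule)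
    fix z assume "z \<in> {z. fst z + snd z = \<alpha>}"
    then have "sum \<alpha> UNIV = sum (fst z) UNIV + sum (snd z) UNIV"
      by (auto simp: sum.distrib)
    then have "fst z \<noteq> unit_index (i, q) \<or> sum (snd z) UNIV \<noteq> m"
      using Suc.prems sum_unit_index[of "(i, q)"] by auto
    then show "(if fst z = unit_index (i, q) then 1 else 0) * matpow_coeff m q j (snd z) = 0"
      using Suc.IH by auto
  qed
  then show ?case by simp
qed

lemma suminf_matrix_component:
  fixes X :: "nat \<Rightarrow> real^'n^'m"
  assumes "\<And>i j. (\<lambda>m. X m $ i $ j) sums s i j"
  shows "(\<Sum>m. X m) $ i $ j = s i j"
proof -
  have "X sums (\<chi> i j. s i j)"
    unfolding sums_def
  proof (intro vec_tendstoI)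
    fix i j
    show "(\<lambda>k. (\<Sum>m<k. X m) $ i $ j) \<longlonglongrightarrow> (\<chi> i j. s i j) $ i $ j"
      using assms[of i j] by (simp add: sums_def)
  qed
  then show ?thesis by (simp add: sums_unique[symmetric])
qed

lemma matpow_entry_bound:
  fixes A :: "real^'n^'n"
  assumes "\<And>i j. 0 \<le> A $ i $ j" "\<And>i j. A $ i $ j \<le> \<rho>"
  shows "0 \<le> matpow A m $ i $ j \<and> matpow A m $ i $ j \<le> (real CARD('n) * \<rho>) ^ m"
proof (induction m arbitrary: i)
  case 0
  show ?case by (simp add: mat_def)
next
  case (Suc m)
  have \<rho>: "0 \<le> \<rho>" using assms order_trans by blast
  have "(\<Sum>q\<in>UNIV. A $ i $ q * matpow A m $ q $ j) \<le> (\<Sum>q\<in>(UNIV :: 'n set). \<rho> * (real CARD('n) * \<rho>) ^ m)"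
    by (intro sum_mono mult_mono) (use assms Suc \<rho> in auto)
  moreover have "0 \<le> (\<Sum>q\<in>UNIV. A $ i $ q * matpow A m $ q $ j)"
    by (intro sum_nonneg mult_nonneg_nonneg) (use assms Suc in auto)
  ultimately show ?case by (simp add: matrix_matrix_mult_def mult_ac)
qed

text \<open>
  Entries of the \<open>m\<close>-th power are homogeneous of degree \<open>m\<close>, so for a given exponent only the summand \<open>m\<close> equal
  to its degree contributes.
\<close>

definition Lambda_hat_coeff :: "(nat \<Rightarrow> real^'n^'n) \<Rightarrow> 'n \<times> 'n \<Rightarrow> ('n \<times> 'n \<Rightarrow> nat) \<Rightarrow> real" where
  "Lambda_hat_coeff \<Lambda> p \<alpha> =
     (\<Sum>q\<in>UNIV. \<Lambda> (sum \<alpha> UNIV) $ q $ snd p * matpow_coeff (sum \<alpha> UNIV) (fst p) q \<alpha>)"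

text \<open>
  For entries below \<open>1 / CARD('n)\<close> the matrix of absolute values has powers that decay geometrically, which
  dominates the double series over \<open>m\<close> and \<open>\<alpha>\<close>.
\<close>

lemma has_series_Lambda_hat:
  fixes \<Lambda> :: "nat \<Rightarrow> real^'n^'n"
  assumes bound: "\<And>m i j. \<bar>\<Lambda> m $ i $ j\<bar> \<le> b"
  shows "has_series (1 / real CARD('n)) (Lambda_hat_coeff \<Lambda> p) (\<lambda>R. Lambda_hat \<Lambda> R $ fst p $ snd p)"
  unfolding has_series_def
proof (intro allI impI)
  fix R :: "real^'n^'n"
  assume R: "in_box (1 / real CARD('n)) R"
  have b: "0 \<le> b" using bound[of 0] order_trans[OF abs_ge_zero] by blast
  define A :: "real^'n^'n" where "A = (\<chi> i j. \<bar>R $ i $ j\<bar>)"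
  have absA: "entry A q = \<bar>entry R q\<bar>" for q by (simp add: A_def entry_def)
  have A: "in_box (1 / real CARD('n)) A" using R unfolding in_box_def absA by simp
  have mpowA: "\<bar>mpow R \<alpha>\<bar> = mpow A \<alpha>" for \<alpha>
    by (simp add: mpow_def absA abs_prod power_abs)
  have mpowA_nonneg: "0 \<le> mpow A \<alpha>" for \<alpha>
    by (simp flip: mpowA)
  define \<rho> where "\<rho> = Max (range (entry A))"
  have "\<rho> \<in> range (entry A)" unfolding \<rho>_def by (rule Max_in) auto
  then have \<rho>1: "0 \<le> \<rho>" "\<rho> < 1 / real CARD('n)"
    using A unfolding in_box_def by (auto simp: absA)
  have \<rho>2: "A $ i $ j \<le> \<rho>" for i j
    unfolding \<rho>_def by (rule Max_ge) (auto simp: entry_def intro!: image_eqI[of _ _ "(i, j)"])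
  define \<theta> where "\<theta> = real CARD('n) * \<rho>"
  have \<theta>: "0 \<le> \<theta>" "\<theta> < 1"
    using \<rho>1 by (auto simp: \<theta>_def field_simps)
  have powA: "0 \<le> matpow A m $ i $ j" "matpow A m $ i $ j \<le> \<theta> ^ m" for m i j
    using matpow_entry_bound[of A \<rho> m i j] \<rho>2 by (auto simp: A_def \<theta>_def)
  define F where "F = (\<lambda>i j (m, \<alpha>). (\<Sum>q\<in>UNIV. \<Lambda> m $ q $ j * (matpow_coeff m i q \<alpha> * mpow R \<alpha>)))"
  have inner: "((\<lambda>\<alpha>. F i j (m, \<alpha>)) has_sum (matpow R m ** \<Lambda> m) $ i $ j) UNIV" for i j m
  proof -
    have "((\<lambda>\<alpha>. \<Sum>q\<in>UNIV. \<Lambda> m $ q $ j * (matpow_coeff m i q \<alpha> * mpow R \<alpha>)) has_sum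
        (\<Sum>q\<in>UNIV. \<Lambda> m $ q $ j * matpow R m $ i $ q)) UNIV"
      by (intro has_sum_finite_sum has_sum_cmult_right has_seriesD[OF has_series_matpow R])
    then show ?thesis by (simp add: F_def matrix_matrix_mult_def mult.commute)
  qed
  have summable: "F i j summable_on UNIV \<times> UNIV" for i j
  proof (rule abs_summable_summable, rule summable_on_comparison_test)
    let ?G = "\<lambda>(m, \<alpha>). \<Sum>q\<in>UNIV. b * (matpow_coeff m i q \<alpha> * mpow A \<alpha>)"
    show "?G summable_on UNIV \<times> UNIV"
    proof (rule summable_on_SigmaI)
      fix m
      show "((\<lambda>\<alpha>. ?G (m, \<alpha>)) has_sum (\<Sum>q\<in>UNIV. b * matpow A m $ i $ q)) UNIV"
        unfolding prod.case
        by (intro has_sum_finite_sum has_sum_cmult_right has_seriesD[OF has_series_matpow A])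
    next
      have "summable (\<lambda>m. \<Sum>q\<in>(UNIV :: 'n set). b * \<theta> ^ m)"
        by (intro summable_sum summable_mult summable_geometric) (use \<theta> in auto)
      then have "(\<lambda>m. \<Sum>q\<in>(UNIV :: 'n set). b * \<theta> ^ m) summable_on UNIV"
        using b \<theta> by (intro summable_nonneg_imp_summable_on) auto
      then show "(\<lambda>m. \<Sum>q\<in>UNIV. b * matpow A m $ i $ q) summable_on UNIV"
      proof (rule summable_on_comparison_test)
        show "(\<Sum>q\<in>UNIV. b * matpow A m $ i $ q) \<le> (\<Sum>q\<in>(UNIV :: 'n set). b * \<theta> ^ m)" for m
          by (intro sum_mono mult_left_mono powA b)
        show "0 \<le> (\<Sum>q\<in>UNIV. b * matpow A m $ i $ q)" for m
          by (intro sum_nonneg mult_nonneg_nonneg powA b)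
      qed
    next
      fix m \<alpha>
      show "0 \<le> ?G (m, \<alpha>)"
        unfolding prod.case
        by (intro sum_nonneg mult_nonneg_nonneg matpow_coeff_nonneg b mpowA_nonneg)
    qed
    fix z :: "nat \<times> ('n \<times> 'n \<Rightarrow> nat)"
    obtain m \<alpha> where z: "z = (m, \<alpha>)" by (cases z)
    have "norm (F i j (m, \<alpha>)) \<le> (\<Sum>q\<in>UNIV. \<bar>\<Lambda> m $ q $ j * (matpow_coeff m i q \<alpha> * mpow R \<alpha>)\<bar>)"
      unfolding F_def prod.case real_norm_def by (rule sum_abs)
    also have "\<dots> \<le> (\<Sum>q\<in>UNIV. b * (matpow_coeff m i q \<alpha> * mpow A \<alpha>))"
      unfolding abs_mult mpowA abs_of_nonneg[OF matpow_coeff_nonneg]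
      by (intro sum_mono mult_right_mono bound mult_nonneg_nonneg matpow_coeff_nonneg mpowA_nonneg)
    finally show "norm (F i j z) \<le> ?G z" by (simp add: z)
  qed simp
  have sum_F: "(F i j has_sum Lambda_hat \<Lambda> R $ i $ j) (UNIV \<times> UNIV)" for i j
  proof -
    have *: "((\<lambda>m. (matpow R m ** \<Lambda> m) $ i $ j) has_sum infsum (F i j) (UNIV \<times> UNIV)) UNIV" for i j
      by (rule has_sum_SigmaD[OF has_sum_infsum[OF summable] inner])
    have "Lambda_hat \<Lambda> R $ i $ j = infsum (F i j) (UNIV \<times> UNIV)"
      unfolding Lambda_hat_def by (rule suminf_matrix_component) (rule has_sum_imp_sums[OF *])
    then show ?thesis using has_sum_infsum[OF summable] by simp
  qed
  (* The terms with m different from the degree of the exponent are 0. *)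
  define h where "h = (\<lambda>\<alpha> :: 'n \<times> 'n \<Rightarrow> nat. (sum \<alpha> UNIV, \<alpha>))"
  have "inj h" by (auto simp: inj_def h_def)
  have "F i j z = 0" if "z \<notin> range h" for i j z
  proof -
    obtain m \<alpha> where z: "z = (m, \<alpha>)" by (cases z)
    have "sum \<alpha> UNIV \<noteq> m" using that unfolding z h_def by blast
    then show ?thesis by (simp add: F_def z matpow_coeff_degree)
  qed
  then have "(F (fst p) (snd p) has_sum Lambda_hat \<Lambda> R $ fst p $ snd p) (range h)"
    using sum_F[of "fst p" "snd p"] by (subst has_sum_cong_neutral[where T = "UNIV \<times> UNIV"]) auto
  then have "((F (fst p) (snd p) \<circ> h) has_sum Lambda_hat \<Lambda> R $ fst p $ snd p) UNIV"
    using has_sum_reindex[OF \<open>inj h\<close>] by blast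
  moreover have "F (fst p) (snd p) \<circ> h = (\<lambda>\<alpha>. Lambda_hat_coeff \<Lambda> p \<alpha> * mpow R \<alpha>)"
    by (rule ext) (simp add: F_def h_def Lambda_hat_coeff_def sum_distrib_right mult.assoc)
  ultimately show "((\<lambda>\<alpha>. Lambda_hat_coeff \<Lambda> p \<alpha> * mpow R \<alpha>) has_sum Lambda_hat \<Lambda> R $ fst p $ snd p) UNIV"
    by simp
qed

lemma nonzero_indexE:
  assumes "\<alpha> \<noteq> (0 :: 'v \<Rightarrow> nat)"
  obtains p where "\<alpha> p \<noteq> 0"
  using assms by (auto simp: fun_eq_iff)

text \<open>
  Every nonconstant monomial shrinks by at least the factor \<open>t\<close> when the box is scaled by \<open>t \<le> 1\<close>.
\<close>

lemma has_series_near_0: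
  assumes f: "has_series r c f" and "0 < r" "0 < e"
  shows "\<exists>s. 0 < s \<and> s \<le> r \<and> (\<forall>R. in_box s R \<longrightarrow> \<bar>f R - c 0\<bar> < e)"
proof -
  define \<rho> where "\<rho> = r / 2"
  have \<rho>: "0 < \<rho>" "\<rho> < r" using \<open>0 < r\<close> by (auto simp: \<rho>_def)
  define Q :: "real^'a^'a" where "Q = (\<chi> i j. \<rho>)"
  have "in_box r Q" using \<rho> by (simp add: in_box_def entry_def Q_def)
  from has_sum_imp_summable[OF has_seriesD[OF f this]]
  have "(\<lambda>\<alpha>. norm (c \<alpha> * mpow Q \<alpha>)) summable_on UNIV"
    by (rule summable_on_iff_abs_summable_on_real[THEN iffD1])
  then obtain S where S: "((\<lambda>\<alpha>. norm (c \<alpha> * mpow Q \<alpha>)) has_sum S) UNIV"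
    using has_sum_infsum by blast
  have S0: "0 \<le> S" by (rule has_sum_nonneg[OF S]) simp
  define t where "t = min 1 (e / (S + 1))"
  have t: "0 < t" "t \<le> 1" using \<open>0 < e\<close> S0 by (auto simp: t_def)
  have "t * S < e"
  proof -
    have "t * S \<le> e / (S + 1) * S" using S0 by (intro mult_right_mono) (auto simp: t_def)
    also have "\<dots> < e" using \<open>0 < e\<close> S0 by (simp add: field_simps)
    finally show ?thesis .
  qed
  have "\<bar>f R - c 0\<bar> < e" if R: "in_box (t * \<rho>) R" for R
  proof -
    have le: "\<bar>entry R q\<bar> \<le> t * \<rho>" for q using R unfolding in_box_def by (metis less_imp_le)
    have "t * \<rho> \<le> 1 * \<rho>" using t \<rho> by (intro mult_right_mono) auto
    then have "\<bar>entry R q\<bar> < r" for q using le[of q] \<rho> by linarith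
    then have "in_box r R" unfolding in_box_def by blast
    have small: "\<bar>mpow R \<alpha>\<bar> \<le> t * mpow Q \<alpha>" if nz: "\<alpha> \<noteq> 0" for \<alpha>
    proof -
      obtain p where p: "\<alpha> p \<noteq> 0" by (rule nonzero_indexE[OF nz])
      have Q0: "0 \<le> mpow_rest p Q \<alpha>" unfolding mpow_rest_def by (intro prod_nonneg) (simp add: Q_def entry_def \<rho>_def \<open>0 < r\<close> less_imp_le)
      have "\<bar>entry R p\<bar> ^ \<alpha> p \<le> (t * \<rho>) ^ \<alpha> p" by (rule power_mono[OF le]) simp
      also have "\<dots> \<le> t * \<rho> ^ \<alpha> p"
        using p t \<rho> power_decreasing[of 1 "\<alpha> p" t]
        by (simp add: power_mult_distrib mult_right_mono)
      finally have *: "\<bar>entry R p\<bar> ^ \<alpha> p \<le> t * \<rho> ^ \<alpha> p" .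
      have "\<bar>mpow_rest p R \<alpha>\<bar> \<le> mpow_rest p Q \<alpha>"
        unfolding mpow_rest_def abs_prod
      proof (intro prod_mono conjI)
        fix q
        have "\<bar>entry R q\<bar> \<le> \<rho>" using le[of q] \<open>t * \<rho> \<le> 1 * \<rho>\<close> by linarith
        then show "\<bar>entry R q ^ \<alpha> q\<bar> \<le> entry Q q ^ \<alpha> q"
          by (simp add: power_abs Q_def entry_def power_mono)
      qed simp
      then have "\<bar>mpow_rest p R \<alpha>\<bar> * \<bar>entry R p\<bar> ^ \<alpha> p \<le> mpow_rest p Q \<alpha> * (t * \<rho> ^ \<alpha> p)"
        using * Q0 by (intro mult_mono) auto
      then show ?thesis
        unfolding mpow_split[of _ _ p] by (simp add: abs_mult power_abs Q_def entry_def mult_ac)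
    qed
    have "((\<lambda>\<alpha>. c \<alpha> * mpow R \<alpha> + (if \<alpha> = 0 then - c 0 else 0) * mpow R \<alpha>) has_sum f R + - c 0) UNIV"
      by (intro has_sum_add has_seriesD[OF f \<open>in_box r R\<close>] has_seriesD[OF has_series_const \<open>in_box r R\<close>])
    moreover have "((\<lambda>\<alpha>. t * norm (c \<alpha> * mpow Q \<alpha>)) has_sum t * S) UNIV"
      by (rule has_sum_cmult_right[OF S])
    ultimately have "norm (f R + - c 0) \<le> t * S"
    proof (rule norm_infsum_le)
      fix \<alpha> :: "'a \<times> 'a \<Rightarrow> nat"
      show "norm (c \<alpha> * mpow R \<alpha> + (if \<alpha> = 0 then - c 0 else 0) * mpow R \<alpha>) \<le> t * norm (c \<alpha> * mpow Q \<alpha>)"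
      proof (cases "\<alpha> = 0")
        case True
        then show ?thesis using t by simp
      next
        case False
        have "0 \<le> mpow Q \<alpha>"
          unfolding mpow_def by (intro prod_nonneg) (simp add: Q_def entry_def \<rho>_def \<open>0 < r\<close> less_imp_le)
        then show ?thesis
          using False mult_left_mono[OF small[OF False], of "\<bar>c \<alpha>\<bar>"] by (simp add: abs_mult mult_ac)
      qed
    qed
    then show ?thesis using \<open>t * S < e\<close> by simp
  qed
  moreover have "0 < t * \<rho>" "t * \<rho> \<le> r"
    using t \<rho> mult_right_mono[of t 1 \<rho>] by (simp, linarith)
  ultimately show ?thesis by blast
qed

section \<open>The matrices V as sums of coefficients\<close>

lemma partial_deriv_ln:
  assumes "has_series r c f" "in_box r R" "0 < f R"
  shows "partial_deriv (fst q) (snd q) (\<lambda>R. ln (f R)) R = partial_deriv (fst q) (snd q) f R / f R"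
proof -
  obtain D where D: "((\<lambda>t. f (shift_entry q t R)) has_real_derivative D) (at 0)"
    using has_series_derivative[OF assms(1,2)] by blast
  have "shift_entry q 0 R = R" by (simp add: shift_entry_def)
  then have "((\<lambda>t. ln (f (shift_entry q t R))) has_real_derivative 1 / f R * D) (at 0)"
    using DERIV_ln_divide[OF assms(3)] by (intro DERIV_chain2[OF _ D]) simp
  then show ?thesis using D by (simp add: partial_deriv_shift DERIV_imp_deriv)
qed

lemma in_box_mono: "in_box s R \<Longrightarrow> s \<le> r \<Longrightarrow> in_box r R"
  unfolding in_box_def by (meson less_le_trans)

lemma matpow_add: "matpow A (m + n) = matpow A m ** matpow A n"
  by (induction m) (simp_all add: matrix_mul_assoc)

lemma matpow_Suc_right: "matpow A (Suc m) = matpow A m ** A"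
  using matpow_add[of A m 1] by simp

lemma matpow_coeff_add:
  fixes i j :: "'n::{finite,linorder}"
  shows "(\<Sum>q\<in>UNIV. conv (matpow_coeff m i q) (matpow_coeff n q j) \<alpha>) = matpow_coeff (m + n) i j \<alpha>"
proof (rule coefficient_eq_on_slice)
  show "has_series 1 (\<lambda>\<alpha>. \<Sum>q\<in>UNIV. conv (matpow_coeff m i q) (matpow_coeff n q j) \<alpha>)
      (\<lambda>R. \<Sum>q\<in>UNIV. matpow R m $ i $ q * matpow R n $ q $ j)"
    by (intro has_series_sum has_series_mult has_series_matpow)
  show "has_series 1 (matpow_coeff (m + n) i j) (\<lambda>R. matpow R (m + n) $ i $ j)"
    by (rule has_series_matpow)
qed (simp_all add: matpow_add matrix_matrix_mult_def)

text \<open>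
  On the slice of \<open>y\<close> the extra factor \<open>f p R\<close> of row \<open>p\<close> comes out even if \<open>y p = 0\<close>: then the left-hand row is
  \<open>f p R\<close> times a unit vector, as its other term contains \<open>R\<^sub>p = 0\<close>.
\<close>

lemma good_det_add_unit_on_slice:
  assumes "on_slice y R"
  shows "det (good_matrix f (unit_index p + y) R) = f p R * det (good_matrix f y R)"
proof -
  define w where "w = (\<lambda>q. if q = p then f p R else 1)"
  have "good_matrix f (unit_index p + y) R = (\<chi> q. w q *s good_matrix f y R $ q)"
    unfolding vec_eq_iff
  proof (intro allI)
    fix q k
    have "entry R p = 0" if "y p = 0" using assms that unfolding on_slice_def by blast
    then show "good_matrix f (unit_index p + y) R $ q $ k = (\<chi> q. w q *s good_matrix f y R $ q) $ q $ k"
      by (cases "y p") (auto simp: good_matrix_def w_def unit_index_def)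
  qed
  then have "det (good_matrix f (unit_index p + y) R) = prod w UNIV * det (good_matrix f y R)"
    using det_rows_mul[of w "\<lambda>q. good_matrix f y R $ q"] by (simp only: vec_lambda_eta)
  then show ?thesis by (simp add: w_def)
qed

lemma finite_index_degree: "finite {\<alpha> :: 'v::finite \<Rightarrow> nat. sum \<alpha> UNIV = n}"
proof (rule finite_subset[OF _ finite_index_le[of "\<lambda>_. n"]])
  have "\<alpha> p \<le> sum \<alpha> UNIV" for \<alpha> :: "'v \<Rightarrow> nat" and p
    using member_le_sum[of p UNIV \<alpha>] by simp
  then show "{\<alpha> :: 'v \<Rightarrow> nat. sum \<alpha> UNIV = n} \<subseteq> {\<beta>. \<forall>p. \<beta> p \<le> n}" by blast
qed

text \<open>
  Multiplication by \<open>R\<^sub>p\<close> shifts coefficients; exponents \<open>\<alpha>\<close> with \<open>\<alpha> p = 0\<close> drop out. The family \<open>g\<close> may depend on the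
  exponent, as the function under the derivatives in \<open>C_mat\<close> does.
\<close>

lemma sum_conv_entry:
  fixes g :: "('v::finite \<Rightarrow> nat) \<Rightarrow> ('v \<Rightarrow> nat) \<Rightarrow> real"
  shows "(\<Sum>\<alpha> | sum \<alpha> UNIV = Suc n. conv (\<lambda>\<beta>. if \<beta> = unit_index p then 1 else 0) (g \<alpha>) \<alpha>) =
    (\<Sum>\<alpha> | sum \<alpha> UNIV = n. g (unit_index p + \<alpha>) \<alpha>)"
proof -
  have deg: "sum (unit_index p + \<alpha>) UNIV = Suc (sum \<alpha> UNIV)" for \<alpha> :: "'v \<Rightarrow> nat"
    by (simp add: sum.distrib sum_unit_index)
  let ?h = "\<lambda>\<alpha>. conv (\<lambda>\<beta>. if \<beta> = unit_index p then 1 else 0) (g \<alpha>) \<alpha>"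
  have inj: "inj_on (\<lambda>\<alpha>. unit_index p + \<alpha>) S" for S :: "('v \<Rightarrow> nat) set"
    by (rule inj_onI) (erule add_left_imp_eq)
  have "(\<Sum>\<alpha> | sum \<alpha> UNIV = Suc n. ?h \<alpha>) =
      (\<Sum>\<alpha>\<in>(\<lambda>\<alpha>. unit_index p + \<alpha>) ` {\<alpha>. sum \<alpha> UNIV = n}. ?h \<alpha>)"
  proof (rule sum.mono_neutral_right[OF finite_index_degree])
    show "(\<lambda>\<alpha>. unit_index p + \<alpha>) ` {\<alpha>. sum \<alpha> UNIV = n} \<subseteq> {\<alpha>. sum \<alpha> UNIV = Suc n}"
      using deg by (auto simp only: mem_Collect_eq image_iff)
    show "\<forall>\<alpha>\<in>{\<alpha>. sum \<alpha> UNIV = Suc n} - (\<lambda>\<alpha>. unit_index p + \<alpha>) ` {\<alpha>. sum \<alpha> UNIV = n}. ?h \<alpha> = 0"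
    proof
      fix \<alpha> :: "'v \<Rightarrow> nat"
      assume \<alpha>: "\<alpha> \<in> {\<alpha>. sum \<alpha> UNIV = Suc n} - (\<lambda>\<alpha>. unit_index p + \<alpha>) ` {\<alpha>. sum \<alpha> UNIV = n}"
      show "?h \<alpha> = 0"
      proof (rule conv_entry_eq_0, rule ccontr)
        assume "\<alpha> p \<noteq> 0"
        define \<beta> where "\<beta> = (\<lambda>q. \<alpha> q - unit_index p q)"
        have eq: "\<alpha> = unit_index p + \<beta>"
          using \<open>\<alpha> p \<noteq> 0\<close> by (auto simp: \<beta>_def unit_index_def fun_eq_iff)
        have "sum \<alpha> UNIV = Suc (sum \<beta> UNIV)" unfolding eq by (rule deg)
        moreover have "sum \<alpha> UNIV = Suc n" using \<alpha> by blast
        ultimately have "\<beta> \<in> {\<alpha>. sum \<alpha> UNIV = n}" by simp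
        with \<alpha> eq show False by blast
      qed
    qed
  qed
  also have "\<dots> = (\<Sum>\<alpha> | sum \<alpha> UNIV = n. ?h (unit_index p + \<alpha>))"
    by (subst sum.reindex[OF inj]) (simp only: o_def)
  finally show ?thesis unfolding conv_entry_shifted .
qed

definition Lambda_hat_entry ::
  "(nat \<Rightarrow> real^'n^'n) \<Rightarrow> 'n \<times> 'n \<Rightarrow> real^'n^'n \<Rightarrow> real" where
  "Lambda_hat_entry \<Lambda> p R = Lambda_hat \<Lambda> R $ fst p $ snd p"

text \<open>
  The choice is harmless: coefficients are unique by \<open>coefficient_eq_on_slice\<close>.
\<close>

definition good_coeff ::
  "(nat \<Rightarrow> real^'n^'n) \<Rightarrow> ('n \<times> 'n \<Rightarrow> nat) \<Rightarrow> ('n \<times> 'n \<Rightarrow> nat) \<Rightarrow> real" where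
  "good_coeff \<Lambda> x = (SOME d. has_series (1 / real CARD('n)) d
     (\<lambda>R. det (good_matrix (Lambda_hat_entry \<Lambda>) x R)))"

text \<open>
  Boundedness gives convergence of \<open>Lambda_hat\<close> on a box, and positivity of \<open>\<Lambda> 0\<close> keeps the logarithms in \<open>Gamma_mat\<close>
  meaningful near 0.
\<close>

definition regular_kernel :: "(nat \<Rightarrow> real^'n^'n) \<Rightarrow> bool" where
  "regular_kernel \<Lambda> \<longleftrightarrow> (\<exists>b. \<forall>m i j. \<bar>\<Lambda> m $ i $ j\<bar> \<le> b) \<and> (\<forall>i j. 0 < \<Lambda> 0 $ i $ j)"

context
  fixes \<Lambda> :: "nat \<Rightarrow> real^'n^'n" and r0 :: real
  assumes \<Lambda>: "regular_kernel \<Lambda>"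
  defines "r0 \<equiv> 1 / real CARD('n)"
begin

lemma r0_pos: "0 < r0"
  by (simp add: r0_def)

lemma \<Lambda>_0_pos: "0 < \<Lambda> 0 $ i $ j"
  using \<Lambda> by (simp add: regular_kernel_def)

lemma has_series_Lambda_hat_entry:
  "has_series r0 (Lambda_hat_coeff \<Lambda> p) (Lambda_hat_entry \<Lambda> p)"
proof -
  obtain b where "\<And>m i j. \<bar>\<Lambda> m $ i $ j\<bar> \<le> b"
    using \<Lambda> unfolding regular_kernel_def by blast
  from has_series_Lambda_hat[OF this] show ?thesis
    unfolding r0_def Lambda_hat_entry_def[abs_def] .
qed

lemma has_series_good_coeff:
  "has_series r0 (good_coeff \<Lambda> x) (\<lambda>R. det (good_matrix (Lambda_hat_entry \<Lambda>) x R))"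
  unfolding good_coeff_def r0_def[symmetric]
  using has_series_good_det[of r0 "Lambda_hat_coeff \<Lambda>" "Lambda_hat_entry \<Lambda>", OF has_series_Lambda_hat_entry]
  by (rule someI_ex)

lemma Lambda_hat_coeff_0: "Lambda_hat_coeff \<Lambda> p 0 = \<Lambda> 0 $ fst p $ snd p"
  by (simp add: Lambda_hat_coeff_def if_distrib[of "\<lambda>z. _ * z"] cong: if_cong)

lemma Lambda_hat_entry_pos_near_0:
  obtains s where "0 < s" "s \<le> r0" "\<And>R p. in_box s R \<Longrightarrow> 0 < Lambda_hat_entry \<Lambda> p R"
proof -
  have "\<exists>s. 0 < s \<and> s \<le> r0 \<and> (\<forall>R. in_box s R \<longrightarrow> 0 < Lambda_hat_entry \<Lambda> p R)" for p
  proof -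
    obtain s where s: "0 < s" "s \<le> r0" and
      near: "\<And>R. in_box s R \<Longrightarrow> \<bar>Lambda_hat_entry \<Lambda> p R - Lambda_hat_coeff \<Lambda> p 0\<bar> < \<Lambda> 0 $ fst p $ snd p"
      using has_series_near_0[OF has_series_Lambda_hat_entry r0_pos \<Lambda>_0_pos] by blast
    have "0 < Lambda_hat_entry \<Lambda> p R" if "in_box s R" for R
      using near[OF that] \<Lambda>_0_pos[of "fst p" "snd p"] unfolding Lambda_hat_coeff_0 by linarith
    with s show ?thesis by blast
  qed
  then obtain s where s: "\<And>p. 0 < s p" "\<And>p. s p \<le> r0"
    "\<And>p R. in_box (s p) R \<Longrightarrow> 0 < Lambda_hat_entry \<Lambda> p R"
    using choice[of "\<lambda>p s. 0 < s \<and> s \<le> r0 \<and> (\<forall>R. in_box s R \<longrightarrow> 0 < Lambda_hat_entry \<Lambda> p R)"] by blast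
  have le: "Min (range s) \<le> s p" for p by (rule Min_le) auto
  show ?thesis
  proof (rule that[of "Min (range s)"])
    show "0 < Min (range s)"
      by (subst Min_gr_iff) (use s(1) in auto)
    show "Min (range s) \<le> r0"
      using le s(2) order_trans by blast
    fix R :: "real^'n^'n" and p assume "in_box (Min (range s)) R"
    from s(3)[OF in_box_mono[OF this le[of p]]] show "0 < Lambda_hat_entry \<Lambda> p R" .
  qed
qed

lemma Gamma_mat_entry:
  assumes "in_box r0 R" "0 < Lambda_hat_entry \<Lambda> p R"
  shows "Gamma_mat \<Lambda> R $ p $ q =
    entry R p * (partial_deriv (fst q) (snd q) (Lambda_hat_entry \<Lambda> p) R / Lambda_hat_entry \<Lambda> p R)"
  using partial_deriv_ln[OF has_series_Lambda_hat_entry assms, of q]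
  by (simp add: Gamma_mat_def case_prod_beta entry_def Lambda_hat_entry_def[abs_def])

text \<open>
  The left-hand side is the factor of \<open>C_mat\<close> that contains quotients; the right-hand side is free of them.
\<close>

lemma det_Gamma_eq_good_det_on_slice:
  assumes R: "in_box r0 R" "on_slice x R" and pos: "\<And>p. 0 < Lambda_hat_entry \<Lambda> p R"
  shows "(\<Prod>p\<in>UNIV. Lambda_hat_entry \<Lambda> p R ^ x p) * det (mat 1 - Gamma_mat \<Lambda> R) =
    det (good_matrix (Lambda_hat_entry \<Lambda>) x R)"
proof -
  have "(\<chi> p. Lambda_hat_entry \<Lambda> p R ^ x p *s (mat 1 - Gamma_mat \<Lambda> R) $ p) =
      good_matrix (Lambda_hat_entry \<Lambda>) x R"
    unfolding vec_eq_iff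
  proof (intro allI)
    fix p q
    have "entry R p = 0" if "x p = 0" using R(2) that unfolding on_slice_def by blast
    then show "(\<chi> p. Lambda_hat_entry \<Lambda> p R ^ x p *s (mat 1 - Gamma_mat \<Lambda> R) $ p) $ p $ q =
        good_matrix (Lambda_hat_entry \<Lambda>) x R $ p $ q"
      using pos[of p] by (cases "x p")
        (simp_all add: good_matrix_def mat_def Gamma_mat_entry[OF R(1) pos] field_simps)
  qed
  then show ?thesis
    using det_rows_mul[of "\<lambda>p. Lambda_hat_entry \<Lambda> p R ^ x p" "\<lambda>p. (mat 1 - Gamma_mat \<Lambda> R) $ p"]
    by (simp only: vec_lambda_eta)
qed

end

context
  fixes \<Lambda> :: "nat \<Rightarrow> real^('n::{finite,linorder})^('n::{finite,linorder})"
  assumes \<Lambda>: "regular_kernel \<Lambda>"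
begin

lemma C_mat_entry:
  "C_mat \<Lambda> x a $ i $ j = (\<Prod>i\<in>UNIV. \<Prod>j\<in>UNIV. fact (x i j)) *
    conv (matpow_coeff a i j) (good_coeff \<Lambda> (\<lambda>p. x (fst p) (snd p))) (\<lambda>p. x (fst p) (snd p))"
proof -
  define \<alpha> where "\<alpha> = (\<lambda>p. x (fst p) (snd p))"
  obtain s where s: "0 < s" "s \<le> 1 / real CARD('n)"
    "\<And>R p. in_box s R \<Longrightarrow> 0 < Lambda_hat_entry \<Lambda> p R"
    using Lambda_hat_entry_pos_near_0[OF \<Lambda>] by blast
  have prod: "(\<Prod>i\<in>UNIV. \<Prod>j\<in>UNIV. (Lambda_hat \<Lambda> R $ i $ j) ^ x i j) =
      (\<Prod>p\<in>UNIV. Lambda_hat_entry \<Lambda> p R ^ \<alpha> p)" for R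
    by (simp add: prod.cartesian_product case_prod_beta Lambda_hat_entry_def \<alpha>_def)
  have "C_mat \<Lambda> x a $ i $ j = multi_deriv x (\<lambda>R. matpow R a $ i $ j *
      det (good_matrix (Lambda_hat_entry \<Lambda>) \<alpha> R)) 0"
    unfolding C_mat_def vec_lambda_beta
  proof (rule multi_deriv_cong_on_slice[OF _ s(1)])
    fix R assume R: "in_box s R" "on_slice (\<lambda>p. x (fst p) (snd p)) R"
    from det_Gamma_eq_good_det_on_slice[OF \<Lambda> in_box_mono[OF R(1) s(2)] R(2) s(3)[OF R(1)]]
    show "matpow R a $ i $ j * (\<Prod>i\<in>UNIV. \<Prod>j\<in>UNIV. (Lambda_hat \<Lambda> R $ i $ j) ^ x i j) *
        det (mat 1 - Gamma_mat \<Lambda> R) =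
        matpow R a $ i $ j * det (good_matrix (Lambda_hat_entry \<Lambda>) \<alpha> R)"
      unfolding prod by (simp only: mult.assoc \<alpha>_def)
  qed
  also have "\<dots> = (\<Prod>i\<in>UNIV. \<Prod>j\<in>UNIV. fact (x i j)) * conv (matpow_coeff a i j) (good_coeff \<Lambda> \<alpha>) \<alpha>"
    unfolding \<alpha>_def
    by (rule multi_deriv_at_0[OF has_series_mult[OF has_series_matpow
          has_series_good_coeff[OF \<Lambda>]]]) simp
  finally show ?thesis unfolding \<alpha>_def .
qed

text \<open>
  The reciprocal factorials in \<open>V_mat\<close> turn derivatives at 0 into coefficients.
\<close>

lemma V_mat_entry:
  "V_mat \<Lambda> n a $ i $ j = (\<Sum>\<alpha> | sum \<alpha> UNIV = n. conv (matpow_coeff a i j) (good_coeff \<Lambda> \<alpha>) \<alpha>)"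
proof -
  have fact: "(\<Prod>i\<in>UNIV. \<Prod>j\<in>UNIV. fact (x i j)) \<noteq> (0::real)" for x :: "'n \<Rightarrow> 'n \<Rightarrow> nat"
    by simp
  have deg: "(\<Sum>i\<in>UNIV. \<Sum>j\<in>UNIV. x i j) = (\<Sum>p\<in>UNIV. x (fst p) (snd p))" for x :: "'n \<Rightarrow> 'n \<Rightarrow> nat"
    by (simp add: sum.cartesian_product case_prod_beta)
  have "V_mat \<Lambda> n a $ i $ j = (\<Sum>x | (\<Sum>i\<in>UNIV. \<Sum>j\<in>UNIV. x i j) = n.
      conv (matpow_coeff a i j) (good_coeff \<Lambda> (\<lambda>p. x (fst p) (snd p))) (\<lambda>p. x (fst p) (snd p)))"
    using fact by (simp add: V_mat_def C_mat_entry)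
  also have "\<dots> = (\<Sum>\<alpha> | sum \<alpha> UNIV = n. conv (matpow_coeff a i j) (good_coeff \<Lambda> \<alpha>) \<alpha>)"
    by (rule sum.reindex_bij_witness[where j = "\<lambda>x p. x (fst p) (snd p)" and i = "\<lambda>\<alpha> i j. \<alpha> (i, j)"])
      (simp_all add: deg)
  finally show ?thesis .
qed

lemma V_mat_zero_steps: "V_mat \<Lambda> 0 a = (if a = 0 then mat 1 else 0)"
  unfolding vec_eq_iff
proof (intro allI)
  fix i j :: 'n
  have "good_coeff \<Lambda> 0 0 = det (good_matrix (Lambda_hat_entry \<Lambda>) 0 0)"
    using has_series_at_0[OF has_series_good_coeff[OF \<Lambda>]] by simp
  also have "good_matrix (Lambda_hat_entry \<Lambda>) 0 0 = mat 1"
    by (simp add: good_matrix_def mat_def)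
  finally have good: "good_coeff \<Lambda> 0 0 = 1" unfolding det_I .
  have "conv (matpow_coeff a i j) (good_coeff \<Lambda> 0) 0 = (if a = 0 \<and> i = j then 1 else 0)"
  proof (cases "a = 0")
    case True
    then show ?thesis
      unfolding matpow_coeff.simps(1) True conv_constant good by simp
  next
    case False
    have "matpow_coeff a i j (fst z) = 0" if "fst z + snd z = 0" for z :: "('n \<times> 'n \<Rightarrow> nat) \<times> ('n \<times> 'n \<Rightarrow> nat)"
    proof (rule matpow_coeff_degree)
      have "fst z p = 0" for p using fun_cong[OF that, of p] by simp
      then show "sum (fst z) UNIV \<noteq> a" using False by simp
    qed
    then show ?thesis
      unfolding conv_def using False by simp
  qed
  moreover have "{\<alpha> :: 'n \<times> 'n \<Rightarrow> nat. sum \<alpha> UNIV = 0} = {0}"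
    by (auto simp: fun_eq_iff)
  ultimately have "V_mat \<Lambda> 0 a $ i $ j = (if a = 0 \<and> i = j then 1 else 0)"
    unfolding V_mat_entry by (simp only: sum.insert[OF finite.emptyI] empty_iff not_False_eq_True sum.empty add_0_right)
  then show "V_mat \<Lambda> 0 a $ i $ j = (if a = 0 then mat 1 else 0) $ i $ j"
    by (simp add: mat_def)
qed

text \<open>
  For level 0 the factor \<open>R\<^sup>a\<close> is the identity matrix, and what remains is Good's identity.
\<close>

lemma V_mat_level_zero:
  assumes "0 < n"
  shows "V_mat \<Lambda> n 0 = 0"
  unfolding vec_eq_iff
proof (intro allI)
  fix i j
  have "conv (matpow_coeff 0 i j) (good_coeff \<Lambda> \<alpha>) \<alpha> = 0" if "sum \<alpha> UNIV = n" for \<alpha>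
  proof -
    have "\<alpha> \<noteq> 0" using that assms by auto
    then have "good_coeff \<Lambda> \<alpha> \<alpha> = 0"
      by (intro good_det_coefficient_eq_0[OF r0_pos[OF \<Lambda>] has_series_Lambda_hat_entry[OF \<Lambda>]
            has_series_good_coeff[OF \<Lambda>]])
    then show ?thesis by (simp add: conv_constant)
  qed
  then show "V_mat \<Lambda> n 0 $ i $ j = 0 $ i $ j"
    by (simp add: V_mat_entry)
qed

section \<open>The last-step recursion for V\<close>

text \<open>
  The coefficient form of \<open>R\<^sup>a F(R) = (\<Sum>c. R\<^sup>a\<^sup>+\<^sup>c \<Lambda>(c))\<close> for \<open>F = Lambda_hat \<Lambda>\<close>; up to degree \<open>n\<close> the terms with \<open>c > n\<close> are invisible.
\<close>

lemma matpow_coeff_mult_Lambda_hat_coeff: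
  assumes "sum \<beta> UNIV \<le> n"
  shows "(\<Sum>q\<in>UNIV. conv (matpow_coeff a i q) (Lambda_hat_coeff \<Lambda> (q, j)) \<beta>) =
    (\<Sum>c\<le>n. \<Sum>k\<in>UNIV. \<Lambda> c $ k $ j * matpow_coeff (a + c) i k \<beta>)"
proof -
  have truncate: "Lambda_hat_coeff \<Lambda> (q, j) \<gamma> =
      (\<Sum>c\<le>n. \<Sum>k\<in>UNIV. \<Lambda> c $ k $ j * matpow_coeff c q k \<gamma>)"
    if "sum \<gamma> UNIV \<le> sum \<beta> UNIV" for q \<gamma>
  proof -
    have "(\<Sum>c\<le>n. \<Sum>k\<in>UNIV. \<Lambda> c $ k $ j * matpow_coeff c q k \<gamma>) =
        (\<Sum>c\<in>{sum \<gamma> UNIV}. \<Sum>k\<in>UNIV. \<Lambda> c $ k $ j * matpow_coeff c q k \<gamma>)"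
      by (rule sum.mono_neutral_right) (use that assms in \<open>auto simp: matpow_coeff_degree\<close>)
    then show ?thesis by (simp add: Lambda_hat_coeff_def)
  qed
  have "(\<Sum>q\<in>UNIV. conv (matpow_coeff a i q) (Lambda_hat_coeff \<Lambda> (q, j)) \<beta>) =
      (\<Sum>q\<in>UNIV. conv (matpow_coeff a i q)
        (\<lambda>\<gamma>. \<Sum>c\<le>n. \<Sum>k\<in>UNIV. \<Lambda> c $ k $ j * matpow_coeff c q k \<gamma>) \<beta>)"
    by (intro sum.cong refl conv_cong_degree truncate)
  also have "\<dots> = (\<Sum>q\<in>UNIV. \<Sum>c\<le>n. \<Sum>k\<in>UNIV. \<Lambda> c $ k $ j *
      conv (matpow_coeff a i q) (matpow_coeff c q k) \<beta>)"
    unfolding conv_sum_right conv_cmult_right ..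
  also have "\<dots> = (\<Sum>c\<le>n. \<Sum>q\<in>UNIV. \<Sum>k\<in>UNIV. \<Lambda> c $ k $ j *
      conv (matpow_coeff a i q) (matpow_coeff c q k) \<beta>)"
    by (rule sum.swap)
  also have "\<dots> = (\<Sum>c\<le>n. \<Sum>k\<in>UNIV. \<Sum>q\<in>UNIV. \<Lambda> c $ k $ j *
      conv (matpow_coeff a i q) (matpow_coeff c q k) \<beta>)"
    by (intro sum.cong refl sum.swap)
  also have "\<dots> = (\<Sum>c\<le>n. \<Sum>k\<in>UNIV. \<Lambda> c $ k $ j * matpow_coeff (a + c) i k \<beta>)"
    unfolding sum_distrib_left[symmetric] matpow_coeff_add ..
  finally show ?thesis .
qed

lemma matpow_coeff_Suc_good:
  "conv (matpow_coeff (Suc a) i j) (good_coeff \<Lambda> x) \<alpha> =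
    (\<Sum>q\<in>UNIV. conv (\<lambda>\<beta>. if \<beta> = unit_index (q, j) then 1 else 0)
      (conv (matpow_coeff a i q) (good_coeff \<Lambda> x)) \<alpha>)"
proof (rule coefficient_eq_on_slice)
  show "has_series (1 / real CARD('n)) (conv (matpow_coeff (Suc a) i j) (good_coeff \<Lambda> x))
      (\<lambda>R. matpow R (Suc a) $ i $ j * det (good_matrix (Lambda_hat_entry \<Lambda>) x R))"
    by (intro has_series_mult has_series_matpow has_series_good_coeff[OF \<Lambda>])
  show "has_series (1 / real CARD('n))
      (\<lambda>\<alpha>. \<Sum>q\<in>UNIV. conv (\<lambda>\<beta>. if \<beta> = unit_index (q, j) then 1 else 0)
        (conv (matpow_coeff a i q) (good_coeff \<Lambda> x)) \<alpha>)
      (\<lambda>R. \<Sum>q\<in>UNIV. entry R (q, j) *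
        (matpow R a $ i $ q * det (good_matrix (Lambda_hat_entry \<Lambda>) x R)))"
    by (intro has_series_sum has_series_mult has_series_entry has_series_matpow
        has_series_good_coeff[OF \<Lambda>])
  show "0 < 1 / real CARD('n)" by simp
  fix R :: "real^('n::{finite,linorder})^('n::{finite,linorder})"
  have "matpow R (Suc a) $ i $ j = (\<Sum>q\<in>UNIV. matpow R a $ i $ q * entry R (q, j))"
    unfolding matpow_Suc_right by (simp add: matrix_matrix_mult_def entry_def)
  then show "matpow R (Suc a) $ i $ j * det (good_matrix (Lambda_hat_entry \<Lambda>) x R) =
      (\<Sum>q\<in>UNIV. entry R (q, j) *
        (matpow R a $ i $ q * det (good_matrix (Lambda_hat_entry \<Lambda>) x R)))"
    by (simp add: sum_distrib_left mult_ac del: matpow.simps)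
qed

text \<open>
  After \<open>R\<^sub>p\<close> has lowered the exponent from \<open>unit_index p + y\<close> to \<open>y\<close>, the power of \<open>f\<^sub>p\<close> is one too large for
  \<open>y\<close>; the surplus factor moves into the first series.
\<close>

lemma good_coeff_add_unit:
  fixes i q :: 'n
  shows
  "conv (matpow_coeff a i q) (good_coeff \<Lambda> (unit_index p + y)) y =
    conv (conv (matpow_coeff a i q) (Lambda_hat_coeff \<Lambda> p)) (good_coeff \<Lambda> y) y"
proof -
  have shifted: "has_series (1 / real CARD('n)) (conv (matpow_coeff a i q) (good_coeff \<Lambda> (unit_index p + y)))
      (\<lambda>R. matpow R a $ i $ q * det (good_matrix (Lambda_hat_entry \<Lambda>) (unit_index p + y) R))"
    by (intro has_series_mult has_series_matpow has_series_good_coeff[OF \<Lambda>])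
  have unshifted: "has_series (1 / real CARD('n))
      (conv (conv (matpow_coeff a i q) (Lambda_hat_coeff \<Lambda> p)) (good_coeff \<Lambda> y))
      (\<lambda>R. matpow R a $ i $ q * Lambda_hat_entry \<Lambda> p R * det (good_matrix (Lambda_hat_entry \<Lambda>) y R))"
    by (intro has_series_mult has_series_matpow has_series_good_coeff[OF \<Lambda>]
        has_series_Lambda_hat_entry[OF \<Lambda>])
  show ?thesis
  proof (rule coefficient_eq_on_slice[OF shifted unshifted])
    fix R :: "real^('n::{finite,linorder})^('n::{finite,linorder})" assume "on_slice y R"
    then show "matpow R a $ i $ q * det (good_matrix (Lambda_hat_entry \<Lambda>) (unit_index p + y) R) =
        matpow R a $ i $ q * Lambda_hat_entry \<Lambda> p R * det (good_matrix (Lambda_hat_entry \<Lambda>) y R)"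
      by (simp only: good_det_add_unit_on_slice mult.assoc)
  qed simp
qed

text \<open>
  The factor \<open>R\<^sub>q\<^sub>j\<close> split off from \<open>R\<^sup>a\<^sup>+\<^sup>1 = R\<^sup>a R\<close> is traded for the entry \<open>(q, j)\<close> of \<open>Lambda_hat\<close>, whose expansion by
  claim size raises the power of \<open>R\<close> again.
\<close>

lemma V_mat_last_step: "V_mat \<Lambda> (Suc n) (Suc a) = (\<Sum>c\<le>n. V_mat \<Lambda> n (a + c) ** \<Lambda> c)"
  unfolding vec_eq_iff
proof (intro allI)
  fix i j :: 'n
  have expand: "(\<Sum>q\<in>UNIV. conv (conv (matpow_coeff a i q) (Lambda_hat_coeff \<Lambda> (q, j))) (good_coeff \<Lambda> y) y) =
      (\<Sum>c\<le>n. \<Sum>k\<in>UNIV. \<Lambda> c $ k $ j * conv (matpow_coeff (a + c) i k) (good_coeff \<Lambda> y) y)"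
    if y: "sum y UNIV = n" for y
  proof -
    have "(\<Sum>q\<in>UNIV. conv (conv (matpow_coeff a i q) (Lambda_hat_coeff \<Lambda> (q, j))) (good_coeff \<Lambda> y) y) =
        conv (\<lambda>\<beta>. \<Sum>q\<in>UNIV. conv (matpow_coeff a i q) (Lambda_hat_coeff \<Lambda> (q, j)) \<beta>) (good_coeff \<Lambda> y) y"
      by (rule conv_sum_left[symmetric])
    also have "\<dots> = conv (\<lambda>\<beta>. \<Sum>c\<le>n. \<Sum>k\<in>UNIV. \<Lambda> c $ k $ j * matpow_coeff (a + c) i k \<beta>) (good_coeff \<Lambda> y) y"
      unfolding y[symmetric] by (intro conv_cong_degree matpow_coeff_mult_Lambda_hat_coeff refl)
    finally show ?thesis unfolding conv_sum_left conv_cmult_left .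
  qed
  have "V_mat \<Lambda> (Suc n) (Suc a) $ i $ j = (\<Sum>q\<in>UNIV. \<Sum>x | sum x UNIV = Suc n.
      conv (\<lambda>\<beta>. if \<beta> = unit_index (q, j) then 1 else 0) (conv (matpow_coeff a i q) (good_coeff \<Lambda> x)) x)"
    unfolding V_mat_entry matpow_coeff_Suc_good by (rule sum.swap)
  also have "\<dots> = (\<Sum>q\<in>UNIV. \<Sum>y | sum y UNIV = n.
      conv (conv (matpow_coeff a i q) (Lambda_hat_coeff \<Lambda> (q, j))) (good_coeff \<Lambda> y) y)"
    unfolding sum_conv_entry good_coeff_add_unit ..
  also have "\<dots> = (\<Sum>y | sum y UNIV = n. \<Sum>q\<in>UNIV.
      conv (conv (matpow_coeff a i q) (Lambda_hat_coeff \<Lambda> (q, j))) (good_coeff \<Lambda> y) y)"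
    by (rule sum.swap)
  also have "\<dots> = (\<Sum>y | sum y UNIV = n. \<Sum>c\<le>n. \<Sum>k\<in>UNIV.
      \<Lambda> c $ k $ j * conv (matpow_coeff (a + c) i k) (good_coeff \<Lambda> y) y)"
    by (intro sum.cong refl expand) blast
  also have "\<dots> = (\<Sum>c\<le>n. \<Sum>y | sum y UNIV = n. \<Sum>k\<in>UNIV.
      \<Lambda> c $ k $ j * conv (matpow_coeff (a + c) i k) (good_coeff \<Lambda> y) y)"
    by (rule sum.swap)
  also have "\<dots> = (\<Sum>c\<le>n. \<Sum>k\<in>UNIV. \<Sum>y | sum y UNIV = n.
      \<Lambda> c $ k $ j * conv (matpow_coeff (a + c) i k) (good_coeff \<Lambda> y) y)"
    by (intro sum.cong refl sum.swap)
  also have "\<dots> = (\<Sum>c\<le>n. \<Sum>k\<in>UNIV. V_mat \<Lambda> n (a + c) $ i $ k * \<Lambda> c $ k $ j)"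
    by (simp only: V_mat_entry sum_distrib_left[symmetric] mult.commute)
  also have "\<dots> = (\<Sum>c\<le>n. V_mat \<Lambda> n (a + c) ** \<Lambda> c) $ i $ j"
    by (simp add: matrix_matrix_mult_def)
  finally show "V_mat \<Lambda> (Suc n) (Suc a) $ i $ j = (\<Sum>c\<le>n. V_mat \<Lambda> n (a + c) ** \<Lambda> c) $ i $ j" .
qed

text \<open>
  In \<open>n\<close> steps the surplus cannot rise by more than \<open>n\<close>.
\<close>

lemma V_mat_eq_0: "n < a \<Longrightarrow> V_mat \<Lambda> n a = 0"
proof (induction n arbitrary: a)
  case 0
  then show ?case by (simp add: V_mat_zero_steps)
next
  case (Suc n)
  then obtain a' where a: "a = Suc a'" "n < a'" by (cases a) auto
  have "V_mat \<Lambda> n (a' + c) = 0" for c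
    by (rule Suc.IH) (use a(2) in simp)
  then show ?case unfolding a(1) V_mat_last_step by simp
qed

end

section \<open>Cutting paths at the last visit to level 0\<close>

lemma matrix_mult_sum_left: "(\<Sum>a\<in>S. f a) ** B = (\<Sum>a\<in>S. f a ** (B :: real^'n^'m))"
  by (simp add: vec_eq_iff matrix_matrix_mult_def sum_distrib_right sum.swap[of _ S])

lemma matrix_mult_sum_right: "(A :: real^'n^'m) ** (\<Sum>a\<in>S. f a) = (\<Sum>a\<in>S. A ** f a)"
  by (induction S rule: infinite_finite_induct) (simp_all add: matrix_add_ldistrib)

lemma matrix_mult_diff_left: "((A :: real^'n^'m) - A') ** B = A ** B - A' ** B"
  by (simp add: vec_eq_iff matrix_matrix_mult_def left_diff_distrib sum_subtractf)

lemma vector_matrix_mult_sum_right: "v v* (\<Sum>a\<in>S. f a) = (\<Sum>a\<in>S. v v* (f a :: real^'n^'m))"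
  by (induction S rule: infinite_finite_induct) (simp_all add: vector_matrix_mult_add_rdistrib)

lemma finite_compositions: "finite {ms :: nat list. length ms = n \<and> sum_list ms = m}"
proof (rule finite_subset)
  show "{ms :: nat list. length ms = n \<and> sum_list ms = m} \<subseteq> {ms. set ms \<subseteq> {..m} \<and> length ms = n}"
    using member_le_sum_list by fastforce
qed (rule finite_lists_length_eq, simp)

lemma conv_power_0: "conv_power \<Lambda> 0 m = (if m = 0 then mat 1 else 0)"
proof -
  have "{ms :: nat list. length ms = 0 \<and> sum_list ms = m} = (if m = 0 then {[]} else {})"
    by auto
  then show ?thesis by (simp add: conv_power_def)
qed

lemma conv_power_Suc: "conv_power \<Lambda> (Suc n) m = (\<Sum>c\<le>m. conv_power \<Lambda> n (m - c) ** \<Lambda> c)"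
proof -
  define word where "word = (\<lambda>ms. foldr (\<lambda>k A. \<Lambda> k ** A) ms (mat 1))"
  have word_init: "foldr (\<lambda>k A. \<Lambda> k ** A) ms B = word ms ** B" for ms B
    by (induction ms) (simp_all add: word_def matrix_mul_assoc)
  have "(\<Sum>c\<le>m. conv_power \<Lambda> n (m - c) ** \<Lambda> c) =
      (\<Sum>c\<le>m. \<Sum>ms | length ms = n \<and> sum_list ms = m - c. word ms ** \<Lambda> c)"
    by (simp add: conv_power_def word_def matrix_mult_sum_left)
  also have "\<dots> = (\<Sum>(c, ms)\<in>Sigma {..m} (\<lambda>c. {ms. length ms = n \<and> sum_list ms = m - c}). word ms ** \<Lambda> c)"
    by (rule sum.Sigma) (simp_all add: finite_compositions)
  also have "\<dots> = (\<Sum>ms | length ms = Suc n \<and> sum_list ms = m. word ms)"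
  proof (rule sum.reindex_bij_witness[where j = "\<lambda>(c, ms). ms @ [c]" and i = "\<lambda>ms. (last ms, butlast ms)"])
    fix ms :: "nat list" assume "ms \<in> {ms. length ms = Suc n \<and> sum_list ms = m}"
    then have ms: "length ms = Suc n" "sum_list ms = m" by auto
    then have "ms = butlast ms @ [last ms]" by (cases ms rule: rev_cases) auto
    then have "sum_list ms = sum_list (butlast ms) + last ms"
      by (metis sum_list.append sum_list.Cons sum_list.Nil add_0_right)
    with ms show "(last ms, butlast ms) \<in> Sigma {..m} (\<lambda>c. {ms. length ms = n \<and> sum_list ms = m - c})"
      by auto
    show "(case (last ms, butlast ms) of (c, ms) \<Rightarrow> ms @ [c]) = ms"
      using \<open>ms = butlast ms @ [last ms]\<close> by simp
  next
    fix z assume "z \<in> Sigma {..m} (\<lambda>c. {ms. length ms = n \<and> sum_list ms = m - c})"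
    then show "(case z of (c, ms) \<Rightarrow> ms @ [c]) \<in> {ms. length ms = Suc n \<and> sum_list ms = m}"
      "(last (case z of (c, ms) \<Rightarrow> ms @ [c]), butlast (case z of (c, ms) \<Rightarrow> ms @ [c])) = z"
      "word (case z of (c, ms) \<Rightarrow> ms @ [c]) = (case z of (c, ms) \<Rightarrow> word ms ** \<Lambda> c)"
      by (auto simp: word_init[symmetric]) (simp add: word_def)
  qed
  finally show ?thesis by (simp add: conv_power_def word_def)
qed

text \<open>
  The weight of all paths of \<open>n\<close> steps with total claim amount \<open>m\<close>, minus that of the ruined ones, which are
  cut at their last visit to 0 at time \<open>k\<close>. From there they climb to \<open>x + n - m\<close> in the remaining \<open>n - k\<close> steps.
\<close>

definition survival_matrix :: "(nat \<Rightarrow> real^('n::{finite,linorder})^('n::{finite,linorder})) \<Rightarrow>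
    nat \<Rightarrow> nat \<Rightarrow> nat \<Rightarrow> real^('n::{finite,linorder})^('n::{finite,linorder})" where
  "survival_matrix \<Lambda> x n m = conv_power \<Lambda> n m -
     (\<Sum>k=1..n. conv_power \<Lambda> k (x + k) ** V_mat \<Lambda> (n - k) (x + n - m))"

context
  fixes \<Lambda> :: "nat \<Rightarrow> real^('n::{finite,linorder})^('n::{finite,linorder})"
  assumes \<Lambda>: "regular_kernel \<Lambda>"
begin

lemma V_mat_last_step_upto:
  assumes "n \<le> a + K"
  shows "V_mat \<Lambda> (Suc n) (Suc a) = (\<Sum>c\<le>K. V_mat \<Lambda> n (a + c) ** \<Lambda> c)"
proof -
  have zero: "V_mat \<Lambda> n (a + c) ** \<Lambda> c = 0" if "n < a + c" for c
    by (simp add: V_mat_eq_0[OF \<Lambda> that])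
  have "(\<Sum>c\<le>n. V_mat \<Lambda> n (a + c) ** \<Lambda> c) = (\<Sum>c\<in>{..n} \<inter> {..K}. V_mat \<Lambda> n (a + c) ** \<Lambda> c)"
    by (rule sum.mono_neutral_right) (use assms in \<open>auto intro!: zero\<close>)
  also have "\<dots> = (\<Sum>c\<le>K. V_mat \<Lambda> n (a + c) ** \<Lambda> c)"
    by (rule sum.mono_neutral_left) (auto intro!: zero)
  finally show ?thesis by (simp add: V_mat_last_step[OF \<Lambda>])
qed

lemma survival_matrix_0: "survival_matrix \<Lambda> x 0 m = (if m = 0 then mat 1 else 0)"
  by (simp add: survival_matrix_def conv_power_0)

text \<open>
  Final level 0: the last visit to 0 is the final time itself, so the subtracted paths are all paths.
\<close>

lemma survival_matrix_ruined: "survival_matrix \<Lambda> x (Suc n) (x + Suc n) = 0"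
proof -
  have "(\<Sum>k=1..Suc n. conv_power \<Lambda> k (x + k) ** V_mat \<Lambda> (Suc n - k) 0) =
      (\<Sum>k\<in>{Suc n}. conv_power \<Lambda> k (x + k) ** V_mat \<Lambda> (Suc n - k) 0)"
    by (rule sum.mono_neutral_right) (auto simp: V_mat_level_zero[OF \<Lambda>])
  then show ?thesis by (simp add: survival_matrix_def V_mat_zero_steps[OF \<Lambda>])
qed

lemma survival_matrix_Suc:
  assumes "m \<le> x + n"
  shows "survival_matrix \<Lambda> x (Suc n) m = (\<Sum>c\<le>m. survival_matrix \<Lambda> x n (m - c) ** \<Lambda> c)"
proof -
  have step: "V_mat \<Lambda> (Suc n - k) (x + Suc n - m) = (\<Sum>c\<le>m. V_mat \<Lambda> (n - k) (x + n - (m - c)) ** \<Lambda> c)"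
    if "k \<in> {1..n}" for k
  proof -
    have "V_mat \<Lambda> (Suc (n - k)) (Suc (x + n - m)) = (\<Sum>c\<le>m. V_mat \<Lambda> (n - k) (x + n - m + c) ** \<Lambda> c)"
      by (rule V_mat_last_step_upto) (use assms in linarith)
    moreover have "x + n - (m - c) = x + n - m + c" if "c \<le> m" for c using that assms by linarith
    ultimately show ?thesis using that assms by (simp add: Suc_diff_le)
  qed
  have "V_mat \<Lambda> 0 (x + Suc n - m) = 0"
    using assms by (simp add: V_mat_zero_steps[OF \<Lambda>])
  then have "(\<Sum>k=1..Suc n. conv_power \<Lambda> k (x + k) ** V_mat \<Lambda> (Suc n - k) (x + Suc n - m)) =
      (\<Sum>k=1..n. conv_power \<Lambda> k (x + k) ** V_mat \<Lambda> (Suc n - k) (x + Suc n - m))"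
    by simp
  also have "\<dots> = (\<Sum>k=1..n. \<Sum>c\<le>m. conv_power \<Lambda> k (x + k) ** V_mat \<Lambda> (n - k) (x + n - (m - c)) ** \<Lambda> c)"
    by (intro sum.cong refl) (simp only: step matrix_mult_sum_right matrix_mul_assoc)
  also have "\<dots> = (\<Sum>c\<le>m. (\<Sum>k=1..n. conv_power \<Lambda> k (x + k) ** V_mat \<Lambda> (n - k) (x + n - (m - c))) ** \<Lambda> c)"
    by (subst sum.swap) (simp add: matrix_mult_sum_left)
  finally show ?thesis
    by (simp add: survival_matrix_def conv_power_Suc matrix_mult_diff_left sum_subtractf)
qed

text \<open>
  The double sum of the theorem runs over \<open>j = x + k\<close>, and its inner range leaves out exactly the levels that cannot be
  reached in \<open>n - k\<close> steps. The term \<open>k = n\<close> is absent because the final level is positive.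
\<close>

lemma sum_survival_matrix:
  assumes "1 \<le> n"
  shows "(\<Sum>m<x + n. survival_matrix \<Lambda> x n m) = (\<Sum>i=0..x+n-1. conv_power \<Lambda> n i)
    - (\<Sum>j=x+1..x+n-1. \<Sum>\<nu>=j..x+n-1. conv_power \<Lambda> (j - x) j ** V_mat \<Lambda> (n + x - j) (n + x - \<nu>))"
proof -
  have range: "{..<x + n} = {0..x+n-1}" using assms by auto
  have "(\<Sum>m<x + n. \<Sum>k=1..n. conv_power \<Lambda> k (x + k) ** V_mat \<Lambda> (n - k) (x + n - m)) =
      (\<Sum>k=1..n. \<Sum>m<x + n. conv_power \<Lambda> k (x + k) ** V_mat \<Lambda> (n - k) (x + n - m))"
    by (rule sum.swap)
  also have "\<dots> = (\<Sum>k=1..n. \<Sum>m=x+k..x+n-1. conv_power \<Lambda> k (x + k) ** V_mat \<Lambda> (n - k) (x + n - m))"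
  proof (rule sum.cong[OF refl], rule sum.mono_neutral_right)
    fix k assume k: "k \<in> {1..n}"
    show "\<forall>m\<in>{..<x + n} - {x+k..x+n-1}. conv_power \<Lambda> k (x + k) ** V_mat \<Lambda> (n - k) (x + n - m) = 0"
    proof
      fix m assume "m \<in> {..<x + n} - {x+k..x+n-1}"
      then have "n - k < x + n - m" using k by auto
      then show "conv_power \<Lambda> k (x + k) ** V_mat \<Lambda> (n - k) (x + n - m) = 0"
        by (simp add: V_mat_eq_0[OF \<Lambda>])
    qed
  qed (use assms in auto)
  also have "\<dots> = (\<Sum>k=1..n-1. \<Sum>m=x+k..x+n-1. conv_power \<Lambda> k (x + k) ** V_mat \<Lambda> (n - k) (x + n - m))"
    by (rule sum.mono_neutral_right) (use assms in auto)
  also have "\<dots> = (\<Sum>j=x+1..x+n-1. \<Sum>\<nu>=j..x+n-1.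
      conv_power \<Lambda> (j - x) j ** V_mat \<Lambda> (n + x - j) (n + x - \<nu>))"
    by (rule sum.reindex_bij_witness[where i = "\<lambda>j. j - x" and j = "\<lambda>k. x + k"])
      (use assms in \<open>auto simp: add.commute\<close>)
  finally show ?thesis
    unfolding survival_matrix_def sum_subtractf range by simp
qed

end

section \<open>The law of the surviving paths\<close>

definition survives :: "(nat \<Rightarrow> 'w \<Rightarrow> nat) \<Rightarrow> nat \<Rightarrow> nat \<Rightarrow> 'w \<Rightarrow> bool" where
  "survives C x n \<omega> \<longleftrightarrow> (\<forall>k\<in>{1..n}. (\<Sum>l=1..k. C l \<omega>) < x + k)"

lemma ruin_time_ge_iff_survives: "enat (n + 1) \<le> ruin_time C x \<omega> \<longleftrightarrow> survives C x n \<omega>"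
proof -
  have pos: "0 < surplus C x k \<omega> \<longleftrightarrow> (\<Sum>l=1..k. C l \<omega>) < x + k" for k
    unfolding surplus_def by linarith
  have "enat (n + 1) \<le> ruin_time C x \<omega> \<longleftrightarrow> (\<forall>k. 0 < k \<and> surplus C x k \<omega> \<le> 0 \<longrightarrow> n + 1 \<le> k)"
    unfolding ruin_time_def le_Inf_iff by (auto simp del: of_nat_sum)
  also have "\<dots> \<longleftrightarrow> (\<forall>k\<in>{1..n}. 0 < surplus C x k \<omega>)"
    by (metis Suc_eq_plus1 Suc_le_eq atLeastAtMost_iff not_le One_nat_def)
  finally show ?thesis unfolding survives_def pos .
qed

context compound_markov_binomial
begin

lemma past_measurable: "past J C k \<in> measurable M (count_space UNIV)"
proof -
  have map_measurable: "(\<lambda>\<omega>. map (\<lambda>l. f l \<omega>) ls) \<in> measurable M (count_space UNIV)"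
    if "\<And>l. l \<in> set ls \<Longrightarrow> f l \<in> measurable M (count_space UNIV)"
    for f :: "nat \<Rightarrow> 'w \<Rightarrow> 'c::countable" and ls
    using that
  proof (induction ls)
    case (Cons a ls)
    have "(\<lambda>\<omega>. f a \<omega> # map (\<lambda>l. f l \<omega>) ls) \<in> measurable M (count_space UNIV)"
    proof (rule measurable_compose_countable[where f = "\<lambda>i \<omega>. i # map (\<lambda>l. f l \<omega>) ls"])
      show "(\<lambda>\<omega>. i # map (\<lambda>l. f l \<omega>) ls) \<in> measurable M (count_space UNIV)" for i
        by (rule measurable_compose[OF Cons.IH measurable_count_space]) (use Cons.prems in auto)
    qed (use Cons.prems in auto)
    then show ?case by simp
  qed simp
  have Js: "(\<lambda>\<omega>. map (\<lambda>l. J l \<omega>) [0..<Suc k]) \<in> measurable M (count_space UNIV)"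
    by (rule map_measurable) (rule J_measurable)
  have Cs: "(\<lambda>\<omega>. map (\<lambda>l. C l \<omega>) [1..<Suc k]) \<in> measurable M (count_space UNIV)"
    by (rule map_measurable) (auto intro: C_measurable)
  have "(\<lambda>\<omega>. (map (\<lambda>l. J l \<omega>) [0..<Suc k], map (\<lambda>l. C l \<omega>) [1..<Suc k])) \<in> measurable M (count_space UNIV)"
    by (rule measurable_compose_countable[where f = "\<lambda>js \<omega>. (js, map (\<lambda>l. C l \<omega>) [1..<Suc k])", OF _ Js])
      (rule measurable_compose[OF Cs measurable_count_space])
  then show ?thesis by (simp only: past_def[abs_def])
qed

lemma past_event: "{\<omega> \<in> space M. past J C k \<omega> \<in> B} \<in> events"
  using measurable_sets[OF past_measurable, of B k] by (simp add: vimage_def Int_def conj_commute)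

lemma J_event: "{\<omega> \<in> space M. J k \<omega> = i} \<in> events"
  using measurable_sets[OF J_measurable, of "{i}" k] by (simp add: vimage_def Int_def conj_commute)

lemma C_event: "1 \<le> k \<Longrightarrow> {\<omega> \<in> space M. C k \<omega> = c} \<in> events"
  using measurable_sets[OF C_measurable, of k "{c}"] by (simp add: vimage_def Int_def conj_commute)

text \<open>
  The Markov additive property in unconditional form. For a state of probability 0 both sides vanish, whatever
  the conditional probabilities are.
\<close>

lemma prob_next_step:
  "\<P>(\<omega> in M. past J C k \<omega> \<in> B \<and> C (Suc k) \<omega> = c \<and> J (Suc k) \<omega> = j) =
    (\<Sum>i\<in>UNIV. \<P>(\<omega> in M. past J C k \<omega> \<in> B \<and> J k \<omega> = i) * \<Lambda> c $ i $ j)"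
proof -
  have events: "{\<omega> \<in> space M. past J C k \<omega> \<in> B \<and> C (Suc k) \<omega> = c \<and> J (Suc k) \<omega> = j} \<in> events"
    "{\<omega> \<in> space M. (past J C k \<omega> \<in> B \<and> C (Suc k) \<omega> = c \<and> J (Suc k) \<omega> = j) \<and> J k \<omega> = i} \<in> events" for i
    by (intro sets.sets_Collect_conj past_event J_event C_event; simp)+
  have "\<P>(\<omega> in M. past J C k \<omega> \<in> B \<and> C (Suc k) \<omega> = c \<and> J (Suc k) \<omega> = j) =
      (\<Sum>i\<in>UNIV. \<P>(\<omega> in M. (past J C k \<omega> \<in> B \<and> C (Suc k) \<omega> = c \<and> J (Suc k) \<omega> = j) \<and> J k \<omega> = i))"
    by (rule prob_sum) (use events in auto)
  also have "\<dots> = (\<Sum>i\<in>UNIV. \<P>(\<omega> in M. past J C k \<omega> \<in> B \<and> J k \<omega> = i) * \<Lambda> c $ i $ j)"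
  proof (rule sum.cong[OF refl])
    fix i
    let ?p = "\<P>(\<omega> in M. J k \<omega> = i)"
    show "\<P>(\<omega> in M. (past J C k \<omega> \<in> B \<and> C (Suc k) \<omega> = c \<and> J (Suc k) \<omega> = j) \<and> J k \<omega> = i) =
        \<P>(\<omega> in M. past J C k \<omega> \<in> B \<and> J k \<omega> = i) * \<Lambda> c $ i $ j"
    proof (cases "0 < ?p")
      case True
      have "\<P>(\<omega> in M. ((C (Suc k) \<omega> = c \<and> J (Suc k) \<omega> = j) \<and> past J C k \<omega> \<in> B) \<and> J k \<omega> = i) / ?p =
          \<Lambda> c $ i $ j * (\<P>(\<omega> in M. past J C k \<omega> \<in> B \<and> J k \<omega> = i) / ?p)"
        using independent_past[of k c j B i] unfolding kernel[OF True] unfolding cond_prob_def .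
      moreover have "{\<omega> \<in> space M. ((C (Suc k) \<omega> = c \<and> J (Suc k) \<omega> = j) \<and> past J C k \<omega> \<in> B) \<and> J k \<omega> = i} =
          {\<omega> \<in> space M. (past J C k \<omega> \<in> B \<and> C (Suc k) \<omega> = c \<and> J (Suc k) \<omega> = j) \<and> J k \<omega> = i}"
        by auto
      ultimately show ?thesis using True by (simp add: field_simps)
    next
      case False
      then have p: "?p = 0" using measure_nonneg[of M "{\<omega> \<in> space M. J k \<omega> = i}"] by linarith
      have null: "\<P>(\<omega> in M. Q \<omega> \<and> J k \<omega> = i) = 0" for Q
      proof -
        have "\<P>(\<omega> in M. Q \<omega> \<and> J k \<omega> = i) \<le> ?p"
          by (rule finite_measure_mono) (auto simp: J_event)
        then show ?thesis using p measure_nonneg[of M "{\<omega> \<in> space M. Q \<omega> \<and> J k \<omega> = i}"] by linarith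
      qed
      show ?thesis unfolding null by simp
    qed
  qed
  finally show ?thesis .
qed

definition survival_law :: "nat \<Rightarrow> nat \<Rightarrow> nat \<Rightarrow> real^'n" where
  "survival_law x n m =
     (\<chi> j. \<P>(\<omega> in M. (survives C x n \<omega> \<and> (\<Sum>l=1..n. C l \<omega>) = m) \<and> J n \<omega> = j))"

text \<open>
  Survival and total claim amount as an event of the past, to which \<open>prob_next_step\<close> applies.
\<close>

definition survival_pasts :: "nat \<Rightarrow> nat \<Rightarrow> nat \<Rightarrow> ('n list \<times> nat list) set" where
  "survival_pasts x n m = {(js, cs). (\<forall>k\<in>{1..n}. sum_list (take k cs) < x + k) \<and> sum_list cs = m}"

lemma past_in_survival_pasts:
  "past J C n \<omega> \<in> survival_pasts x n m \<longleftrightarrow> survives C x n \<omega> \<and> (\<Sum>l=1..n. C l \<omega>) = m"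
proof -
  have total: "sum_list (map (\<lambda>l. C l \<omega>) [1..<Suc k]) = (\<Sum>l=1..k. C l \<omega>)" for k
    unfolding interv_sum_list_conv_sum_set_nat set_upt atLeastLessThanSuc_atLeastAtMost by (rule refl)
  have take: "sum_list (take k (map (\<lambda>l. C l \<omega>) [1..<Suc n])) = (\<Sum>l=1..k. C l \<omega>)"
    if "k \<in> {1..n}" for k
  proof -
    have "take k [1..<Suc n] = [1..<1 + k]" using that by (intro take_upt) auto
    then show ?thesis unfolding take_map using total[of k] by simp
  qed
  show ?thesis
    unfolding survival_pasts_def past_def survives_def mem_Collect_eq prod.case total
    by (simp only: take cong: ball_cong)
qed

lemma survival_law_eq_past:
  "survival_law x n m $ j = \<P>(\<omega> in M. past J C n \<omega> \<in> survival_pasts x n m \<and> J n \<omega> = j)"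
  by (simp add: survival_law_def past_in_survival_pasts)

lemma survival_law_0: "survival_law x 0 m = (if m = 0 then \<pi> else 0)"
  by (simp add: vec_eq_iff survival_law_def survives_def initial)

text \<open>
  Survival up to time \<open>n + 1\<close> is survival up to time \<open>n\<close> together with positivity of the final surplus, which only
  depends on the total claim amount \<open>m\<close>.
\<close>

lemma survival_law_Suc:
  "survival_law x (Suc n) m = (if m < x + Suc n then \<Sum>c\<le>m. survival_law x n (m - c) v* \<Lambda> c else 0)"
  unfolding vec_eq_iff
proof (intro allI)
  fix j
  have survives_Suc: "survives C x (Suc n) \<omega> \<longleftrightarrow> survives C x n \<omega> \<and> (\<Sum>l=1..Suc n. C l \<omega>) < x + Suc n" for \<omega>
  proof -
    have "(\<forall>k\<in>{1..Suc n}. Q k) \<longleftrightarrow> (\<forall>k\<in>{1..n}. Q k) \<and> Q (Suc n)" for Q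
      unfolding Ball_def by (auto simp: le_Suc_eq)
    then show ?thesis unfolding survives_def .
  qed
  show "survival_law x (Suc n) m $ j =
      (if m < x + Suc n then \<Sum>c\<le>m. survival_law x n (m - c) v* \<Lambda> c else 0) $ j"
  proof (cases "m < x + Suc n")
    case False
    then have empty: "{\<omega> \<in> space M. (survives C x (Suc n) \<omega> \<and> (\<Sum>l=1..Suc n. C l \<omega>) = m) \<and> J (Suc n) \<omega> = j} = {}"
      unfolding survives_Suc by auto
    have "survival_law x (Suc n) m $ j = 0"
      unfolding survival_law_def vec_lambda_beta empty by (rule measure_empty)
    with False show ?thesis by simp
  next
    case True
    have "survival_law x (Suc n) m $ j = (\<Sum>c\<le>m.
        \<P>(\<omega> in M. past J C n \<omega> \<in> survival_pasts x n (m - c) \<and> C (Suc n) \<omega> = c \<and> J (Suc n) \<omega> = j))"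
      unfolding survival_law_eq_past
    proof (rule prob_sum)
      show "{\<omega> \<in> space M. past J C n \<omega> \<in> survival_pasts x n (m - c) \<and> C (Suc n) \<omega> = c \<and> J (Suc n) \<omega> = j} \<in> events" for c
        by (intro sets.sets_Collect_conj past_event J_event C_event) simp
      show "{\<omega> \<in> space M. past J C (Suc n) \<omega> \<in> survival_pasts x (Suc n) m \<and> J (Suc n) \<omega> = j} \<in> events"
        by (intro sets.sets_Collect_conj past_event J_event)
      show "AE \<omega> in M. (\<forall>c\<in>{..m}. past J C n \<omega> \<in> survival_pasts x n (m - c) \<and> C (Suc n) \<omega> = c \<and> J (Suc n) \<omega> = j \<longrightarrow>
            past J C (Suc n) \<omega> \<in> survival_pasts x (Suc n) m \<and> J (Suc n) \<omega> = j) \<and>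
          (past J C (Suc n) \<omega> \<in> survival_pasts x (Suc n) m \<and> J (Suc n) \<omega> = j \<longrightarrow>
            (\<exists>!c. c \<in> {..m} \<and> past J C n \<omega> \<in> survival_pasts x n (m - c) \<and> C (Suc n) \<omega> = c \<and> J (Suc n) \<omega> = j))"
        unfolding past_in_survival_pasts survives_Suc
        using True by (intro AE_I2) auto
    qed simp
    also have "\<dots> = (\<Sum>c\<le>m. (survival_law x n (m - c) v* \<Lambda> c) $ j)"
      unfolding prob_next_step by (simp add: vector_matrix_mult_def survival_law_eq_past mult.commute)
    finally show ?thesis using True by simp
  qed
qed

lemma regular_kernel: "regular_kernel \<Lambda>"
proof -
  have "\<Lambda> \<longlonglongrightarrow> 0"
    using \<Lambda>_sums by (intro summable_LIMSEQ_zero) (rule sums_summable)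
  then have "Bseq \<Lambda>" by (intro convergent_imp_Bseq convergentI)
  then obtain b where b: "\<And>m. norm (\<Lambda> m) \<le> b" unfolding Bseq_def by blast
  have "\<bar>\<Lambda> m $ i $ j\<bar> \<le> b" for m i j
    using component_le_norm_cart[of "\<Lambda> m $ i" j] Finite_Cartesian_Product.norm_nth_le[of "\<Lambda> m" i] b[of m]
    by linarith
  then show ?thesis
    unfolding regular_kernel_def using \<Lambda>_0_pos by blast
qed

lemma prob_survives:
  assumes "1 \<le> n"
  shows "\<P>(\<omega> in M. survives C x n \<omega>) = (\<Sum>m<x + n. survival_law x n m) \<bullet> (\<chi> i. 1)"
proof -
  have below: "survives C x n \<omega> \<Longrightarrow> (\<Sum>l=1..n. C l \<omega>) < x + n" for \<omega>
    unfolding survives_def using assms by auto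
  have "\<P>(\<omega> in M. survives C x n \<omega>) = (\<Sum>z\<in>{..<x + n} \<times> UNIV.
      \<P>(\<omega> in M. past J C n \<omega> \<in> survival_pasts x n (fst z) \<and> J n \<omega> = snd z))"
  proof (intro prob_sum)
    have "{\<omega> \<in> space M. survives C x n \<omega>} = {\<omega> \<in> space M. past J C n \<omega> \<in> (\<Union>m. survival_pasts x n m)}"
      by (auto simp: past_in_survival_pasts)
    then show "{\<omega> \<in> space M. survives C x n \<omega>} \<in> events" by (simp only: past_event)
    show "{\<omega> \<in> space M. past J C n \<omega> \<in> survival_pasts x n (fst z) \<and> J n \<omega> = snd z} \<in> events" for z
      by (intro sets.sets_Collect_conj past_event J_event)
    show "AE \<omega> in M. (\<forall>z\<in>{..<x + n} \<times> UNIV.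
        past J C n \<omega> \<in> survival_pasts x n (fst z) \<and> J n \<omega> = snd z \<longrightarrow> survives C x n \<omega>) \<and>
      (survives C x n \<omega> \<longrightarrow> (\<exists>!z. z \<in> {..<x + n} \<times> UNIV \<and>
        past J C n \<omega> \<in> survival_pasts x n (fst z) \<and> J n \<omega> = snd z))"
      using below unfolding past_in_survival_pasts by (intro AE_I2) auto
  qed simp
  also have "\<dots> = (\<Sum>m<x + n. \<Sum>j\<in>UNIV. survival_law x n m $ j)"
    by (simp add: survival_law_eq_past sum.cartesian_product case_prod_beta)
  also have "\<dots> = (\<Sum>m<x + n. survival_law x n m) \<bullet> (\<chi> i. 1)"
    unfolding inner_sum_left by (simp add: inner_vec_def)
  finally show ?thesis .
qed

end

text \<open>
  Both sides satisfy the same recursion. At the boundary \<open>m = x + n\<close> with \<open>n > 0\<close>, where the surplus is 0, the law vanishes by the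
  definition of survival and the matrix by \<open>survival_matrix_ruined\<close>; higher \<open>m\<close> never enter the recursion for
  \<open>m \<le> x + n\<close>.
\<close>

lemma survival_law_eq_survival_matrix:
  fixes J :: "nat \<Rightarrow> 'w \<Rightarrow> 'n::{finite,linorder}"
  assumes model: "compound_markov_binomial M J C P \<pi> \<Lambda>" and "m \<le> x + n"
  shows "compound_markov_binomial.survival_law M J C x n m = \<pi> v* survival_matrix \<Lambda> x n m"
proof -
  interpret compound_markov_binomial M J C P \<pi> \<Lambda> by (rule model)
  show ?thesis using \<open>m \<le> x + n\<close>
  proof (induction n arbitrary: m)
    case 0
    show ?case by (simp add: survival_law_0 survival_matrix_0[OF regular_kernel])
  next
    case (Suc n)
    show ?case
    proof (cases "m = x + Suc n")
      case True
      then show ?thesis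
        unfolding survival_law_Suc True survival_matrix_ruined[OF regular_kernel] by simp
    next
      case False
      with Suc.prems have m: "m \<le> x + n" by simp
      then have "survival_law x (Suc n) m = (\<Sum>c\<le>m. survival_law x n (m - c) v* \<Lambda> c)"
        by (simp add: survival_law_Suc)
      also have "\<dots> = (\<Sum>c\<le>m. (\<pi> v* survival_matrix \<Lambda> x n (m - c)) v* \<Lambda> c)"
        by (intro sum.cong refl arg_cong2[where f = "(v*)"] Suc.IH) (use m in auto)
      also have "\<dots> = \<pi> v* survival_matrix \<Lambda> x (Suc n) m"
        unfolding survival_matrix_Suc[OF regular_kernel m]
        by (simp add: vector_matrix_mult_sum_right vector_matrix_mul_assoc)
      finally show ?thesis .
    qed
  qed
qed

theorem theorem4:
  fixes M :: "'w measure"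
    and J :: "nat \<Rightarrow> 'w \<Rightarrow> 'n::{finite,linorder}"
    and C :: "nat \<Rightarrow> 'w \<Rightarrow> nat"
    and P :: "real^('n::{finite,linorder})^('n::{finite,linorder})"
    and \<pi> :: "real^('n::{finite,linorder})"
    and \<Lambda> :: "nat \<Rightarrow> real^('n::{finite,linorder})^('n::{finite,linorder})"
    and x n :: nat
  assumes "compound_markov_binomial M J C P \<pi> \<Lambda>"
    and "1 \<le> n"
  shows "\<P>(\<omega> in M. enat (n + 1) \<le> ruin_time C x \<omega>) =
    (\<pi> v* ((\<Sum>i=0..x+n-1. conv_power \<Lambda> n i)
         - (\<Sum>j=x+1..x+n-1. \<Sum>\<nu>=j..x+n-1.
              conv_power \<Lambda> (j - x) j ** V_mat \<Lambda> (n + x - j) (n + x - \<nu>))))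
    \<bullet> (\<chi> i. 1)"
proof -
  interpret compound_markov_binomial M J C P \<pi> \<Lambda> by (rule assms(1))
  have "\<P>(\<omega> in M. enat (n + 1) \<le> ruin_time C x \<omega>) = (\<Sum>m<x + n. survival_law x n m) \<bullet> (\<chi> i. 1)"
    unfolding ruin_time_ge_iff_survives by (rule prob_survives[OF assms(2)])
  also have "(\<Sum>m<x + n. survival_law x n m) = \<pi> v* (\<Sum>m<x + n. survival_matrix \<Lambda> x n m)"
    by (simp add: survival_law_eq_survival_matrix[OF assms(1)] vector_matrix_mult_sum_right)
  finally show ?thesis
    unfolding sum_survival_matrix[OF regular_kernel assms(2)] .
qed

end
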